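(* Let $k\ge1$, $s_0\in\mathbb{C}$, and let $f,g:\mathbb{R}^k\setminus\{0\}\to\mathbb{C}$ be $C^\infty$ functions, homogeneous of type $(1,1)$ and $(s_0,1)$ respectively, and assume that $f(x)$ is a positive real number for all $0\neq x\in\mathbb{R}^k$. Then for all $s\in\mathbb{C}$ with $s\neq k+s_0$ the series $\sum_{0\neq n\in\mathbb{Z}^k}f(n)^{-s}g(n)$ is h-summable, and its sum $h(s)$ is a holomorphic function of $s$ on $\mathbb{C}\setminus\{k+s_0\}$. Furthermore, $h$ has at worst a simple pole at $k+s_0$.
   Context: Homogeneity: $f:\mathbb{R}^k\setminus\{0\}\to\mathbb{C}$ is homogeneous of type $(\sigma,\epsilon)\in\mathbb{C}\times\{\pm1\}$ if $f(tx)=t^{\sigma}f(x)$ and $f(-x)=\epsilon f(x)$ for all $t>0$, $x\ne0$. t-summability: for an abelian group $\Gamma$, $a:\Gamma\to\mathbb{C}$ is t-summable if there is a finitely supported $c:\Gamma\to\mathbb{C}$ with $\sum c\neq0$ and $\sum_\gamma|(c*a)(\gamma)|<\infty$, where $(c*a)(\gamma)=\sum_{\gamma'}c(\gamma')a(\gamma-\gamma')$; its sum is then $(\sum c)^{-1}\sum_\gamma(c*a)(\gamma)$, independent of $c$. h-summability (on $\mathbb{Q}^k$): for $t\in\mathbb{Q}^\times$ and $a:\mathbb{Q}^k\to\mathbb{C}$ put $(\rho(t)a)(x)=a(t^{-1}x)$. The function $a$ is h-summable if there is a finitely supported family $(c_t)_{t\in\mathbb{Q}^\times}$ of complex numbers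 with $\sum_tc_t\neq0$ such that $\sum_tc_t\rho(t)a$ is t-summable on the group $\Gamma=\mathbb{Q}^k$; its sum is then defined as $(\sum_tc_t)^{-1}$ times the t-sum of $\sum_tc_t\rho(t)a$ (independent of choices). For $M\subset\mathbb{Q}^k$ and $a:M\to\mathbb{C}$, the series $\sum_{n\in M}a(n)$ is h-summable if the extension of $a$ by zero to $\mathbb{Q}^k$ is, and its sum is the sum of the extension. *)

theory Defs
  imports "HOL-Complex_Analysis.Complex_Analysis"
begin

fun Ck_on :: "nat \<Rightarrow> ('a::real_normed_vector \<Rightarrow> 'b::real_normed_vector) \<Rightarrow> 'a set \<Rightarrow> bool" where
  "Ck_on 0 f S \<longleftrightarrow> continuous_on S f"
| "Ck_on (Suc n) f S \<longleftrightarrow> (\<forall>x\<in>S. f differentiable (at x)) \<and>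
     (\<forall>v. Ck_on n (\<lambda>x. frechet_derivative f (at x) v) S)"

text \<open>Intended for open \<open>S\<close> and a finite-dimensional domain, where continuity of all
  iterated directional derivatives is the usual smoothness.\<close>

definition smooth_on :: "('a::real_normed_vector \<Rightarrow> 'b::real_normed_vector) \<Rightarrow> 'a set \<Rightarrow> bool" where
  "smooth_on f S \<longleftrightarrow> (\<forall>n. Ck_on n f S)"

text \<open>A function on \<open>V - {0}\<close> is represented by a total function whose value at \<open>0\<close> is irrelevant.\<close>

definition homogeneous_of_type ::
    "complex \<Rightarrow> int \<Rightarrow> ('a::real_vector \<Rightarrow> complex) \<Rightarrow> bool" where
  "homogeneous_of_type \<sigma> \<epsilon> f \<longleftrightarrow> \<epsilon> \<in> {1, -1} \<and>
     (\<forall>t>0. \<forall>x. x \<noteq> 0 \<longrightarrow> f (t *\<^sub>R x) = complex_of_real t powr \<sigma> * f x) \<and>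
     (\<forall>x. x \<noteq> 0 \<longrightarrow> f (- x) = of_int \<epsilon> * f x)"

definition total_mass :: "('a \<Rightarrow> complex) \<Rightarrow> complex" where
  "total_mass c = (\<Sum>x | c x \<noteq> 0. c x)"

definition conv :: "('g::ab_group_add \<Rightarrow> complex) \<Rightarrow> ('g \<Rightarrow> complex) \<Rightarrow> 'g \<Rightarrow> complex" where
  "conv c a \<gamma> = (\<Sum>\<gamma>' | c \<gamma>' \<noteq> 0. c \<gamma>' * a (\<gamma> - \<gamma>'))"

definition t_summing :: "('g::ab_group_add \<Rightarrow> complex) \<Rightarrow> ('g \<Rightarrow> complex) \<Rightarrow> bool" where
  "t_summing c a \<longleftrightarrow> finite {\<gamma>. c \<gamma> \<noteq> 0} \<and> total_mass c \<noteq> 0 \<and>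
     (\<lambda>\<gamma>. norm (conv c a \<gamma>)) summable_on UNIV"

definition t_summable :: "('g::ab_group_add \<Rightarrow> complex) \<Rightarrow> bool" where
  "t_summable a \<longleftrightarrow> (\<exists>c. t_summing c a)"

text \<open>The sum is well defined by \<open>t_sum_eq\<close> below.\<close>

definition t_sum :: "('g::ab_group_add \<Rightarrow> complex) \<Rightarrow> complex" where
  "t_sum a = (THE S. \<exists>c. t_summing c a \<and> S = (\<Sum>\<^sub>\<infinity>\<gamma>. conv c a \<gamma>) / total_mass c)"

definition rho :: "rat \<Rightarrow> (rat ^ 'k \<Rightarrow> complex) \<Rightarrow> rat ^ 'k \<Rightarrow> complex" where
  "rho t a x = a (inverse t *s x)"

definition rho_comb :: "(rat \<Rightarrow> complex) \<Rightarrow> (rat ^ 'k \<Rightarrow> complex) \<Rightarrow> rat ^ 'k \<Rightarrow> complex" where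
  "rho_comb c a x = (\<Sum>t | c t \<noteq> 0. c t * rho t a x)"

text \<open>Families indexed by nonzero rationals are functions on \<open>rat\<close> vanishing at \<open>0\<close>.\<close>

definition h_summing :: "(rat \<Rightarrow> complex) \<Rightarrow> (rat ^ 'k \<Rightarrow> complex) \<Rightarrow> bool" where
  "h_summing c a \<longleftrightarrow> finite {t. c t \<noteq> 0} \<and> c 0 = 0 \<and> total_mass c \<noteq> 0 \<and> t_summable (rho_comb c a)"

definition zero_ext :: "'a set \<Rightarrow> ('a \<Rightarrow> complex) \<Rightarrow> 'a \<Rightarrow> complex" where
  "zero_ext M a x = (if x \<in> M then a x else 0)"

definition h_summable_on :: "(rat ^ 'k \<Rightarrow> complex) \<Rightarrow> (rat ^ 'k) set \<Rightarrow> bool" where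
  "h_summable_on a M \<longleftrightarrow> (\<exists>c. h_summing c (zero_ext M a))"

text \<open>The sum is well defined by \<open>h_sum_eq\<close> below.\<close>

definition h_sum :: "(rat ^ 'k \<Rightarrow> complex) \<Rightarrow> (rat ^ 'k) set \<Rightarrow> complex" where
  "h_sum a M = (THE S. \<exists>c. h_summing c (zero_ext M a) \<and>
     S = t_sum (rho_comb c (zero_ext M a)) / total_mass c)"

definition int_lattice :: "(rat ^ 'k) set" where
  "int_lattice = {n. \<forall>i. n $ i \<in> \<int>}"

definition real_vec :: "rat ^ 'k \<Rightarrow> real ^ 'k" where
  "real_vec x = (\<chi> i. of_rat (x $ i))"


subsection \<open>Independence of choices\<close>

lemma conv_superset:
  assumes "finite A" "{x. c x \<noteq> 0} \<subseteq> A"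
  shows "conv c a \<gamma> = (\<Sum>x\<in>A. c x * a (\<gamma> - x))"
  unfolding conv_def by (rule sum.mono_neutral_left) (use assms in auto)

lemma has_sum_fin_sum:
  assumes "finite A" "\<And>x. x \<in> A \<Longrightarrow> (f x has_sum (S x :: complex)) B"
  shows "((\<lambda>\<gamma>. \<Sum>x\<in>A. f x \<gamma>) has_sum (\<Sum>x\<in>A. S x)) B"
  using assms by (induction A rule: finite_induct) (auto intro!: has_sum_add)

lemma has_sum_shift:
  fixes b :: "'g::ab_group_add \<Rightarrow> complex"
  assumes "(b has_sum S) UNIV"
  shows "((\<lambda>\<gamma>. b (\<gamma> - x)) has_sum S) UNIV"
proof -
  have "bij_betw (\<lambda>\<gamma>. \<gamma> - x) UNIV UNIV"
    by (rule bij_betw_byWitness[where f' = "\<lambda>\<gamma>. \<gamma> + x"]) auto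
  from has_sum_reindex_bij_betw[OF this, of b S] assms show ?thesis by simp
qed

lemma has_sum_conv:
  fixes b :: "'g::ab_group_add \<Rightarrow> complex"
  assumes "finite {x. d x \<noteq> 0}" "(b has_sum S) UNIV"
  shows "(conv d b has_sum total_mass d * S) UNIV"
proof -
  have "((\<lambda>\<gamma>. \<Sum>x | d x \<noteq> 0. d x * b (\<gamma> - x)) has_sum (\<Sum>x | d x \<noteq> 0. d x * S)) UNIV"
    by (intro has_sum_fin_sum assms has_sum_cmult_right has_sum_shift)
  then show ?thesis by (simp add: conv_def[abs_def] total_mass_def sum_distrib_right)
qed

lemma abs_iff: "(\<lambda>x. norm (f x)) summable_on A \<longleftrightarrow> f summable_on A" for f :: "'a \<Rightarrow> complex"
  by (rule summable_on_iff_abs_summable_on_complex[symmetric])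

lemma has_sum_total_mass:
  assumes "finite {x. c x \<noteq> 0}" shows "(c has_sum total_mass c) UNIV"
proof -
  have "(c has_sum total_mass c) {x. c x \<noteq> 0}" unfolding total_mass_def using assms by (rule has_sum_finite)
  then show ?thesis using has_sum_cong_neutral[of UNIV "{x. c x \<noteq> 0}" c c "total_mass c"] by auto
qed

lemma conv_comm:
  "conv d (conv c a) = conv c (conv d a)"
  by (rule ext) (simp add: conv_def sum_distrib_left sum.swap[of _ "{x. c x \<noteq> 0}"]
      algebra_simps diff_diff_eq)

lemma finite_supp_conv:
  fixes c d :: "'g::ab_group_add \<Rightarrow> complex"
  assumes "finite {x. c x \<noteq> 0}" "finite {x. d x \<noteq> 0}"
  shows "finite {x. conv c d x \<noteq> 0}"
proof (rule finite_subset)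
  show "finite ((\<lambda>(x, y). x + y) ` ({x. c x \<noteq> 0} \<times> {x. d x \<noteq> 0}))"
    using assms by auto
  show "{x. conv c d x \<noteq> 0} \<subseteq> (\<lambda>(x, y). x + y) ` ({x. c x \<noteq> 0} \<times> {x. d x \<noteq> 0})"
  proof
    fix z assume "z \<in> {x. conv c d x \<noteq> 0}"
    then obtain x where "c x \<noteq> 0" "d (z - x) \<noteq> 0"
      unfolding conv_def by (auto elim!: sum.not_neutral_contains_not_neutral)
    then show "z \<in> (\<lambda>(x, y). x + y) ` ({x. c x \<noteq> 0} \<times> {x. d x \<noteq> 0})"
      by (intro image_eqI[of _ _ "(x, z - x)"]) auto
  qed
qed

lemma total_mass_conv:
  fixes c d :: "'g::ab_group_add \<Rightarrow> complex"
  assumes "finite {x. c x \<noteq> 0}" "finite {x. d x \<noteq> 0}"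
  shows "total_mass (conv c d) = total_mass c * total_mass d"
  by (rule has_sum_unique[OF has_sum_total_mass[OF finite_supp_conv[OF assms]]
        has_sum_conv[OF assms(1) has_sum_total_mass[OF assms(2)]]])

lemma conv_assoc:
  fixes c d a :: "'g::ab_group_add \<Rightarrow> complex"
  assumes c: "finite {x. c x \<noteq> 0}" and d: "finite {x. d x \<noteq> 0}"
  shows "conv (conv c d) a = conv c (conv d a)"
proof
  fix \<gamma>
  define F where "F = {x. conv c d x \<noteq> 0} \<union> (\<lambda>(x, y). x + y) ` ({x. c x \<noteq> 0} \<times> {x. d x \<noteq> 0})"
  have F: "finite F" using c d finite_supp_conv[OF c d] by (auto simp: F_def)
  have inner: "(\<Sum>z\<in>F. d (z - x) * a (\<gamma> - z)) = conv d a (\<gamma> - x)" if "c x \<noteq> 0" for x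
  proof -
    have "(\<Sum>z\<in>F. d (z - x) * a (\<gamma> - z)) = (\<Sum>z\<in>(\<lambda>y. x + y) ` {y. d y \<noteq> 0}. d (z - x) * a (\<gamma> - z))"
    proof (rule sum.mono_neutral_right[OF F])
      show "(\<lambda>y. x + y) ` {y. d y \<noteq> 0} \<subseteq> F" using that by (force simp: F_def)
      show "\<forall>z\<in>F - (\<lambda>y. x + y) ` {y. d y \<noteq> 0}. d (z - x) * a (\<gamma> - z) = 0"
      proof
        fix z assume z: "z \<in> F - (\<lambda>y. x + y) ` {y. d y \<noteq> 0}"
        have "z = x + (z - x)" by simp
        with z have "d (z - x) = 0" by blast
        then show "d (z - x) * a (\<gamma> - z) = 0" by simp
      qed
    qed
    also have "\<dots> = conv d a (\<gamma> - x)"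
      unfolding conv_def by (subst sum.reindex) (auto simp: algebra_simps diff_diff_eq)
    finally show ?thesis .
  qed
  have "conv (conv c d) a \<gamma> = (\<Sum>z\<in>F. conv c d z * a (\<gamma> - z))"
    by (rule conv_superset[OF F]) (auto simp: F_def)
  also have "\<dots> = (\<Sum>z\<in>F. \<Sum>x | c x \<noteq> 0. c x * (d (z - x) * a (\<gamma> - z)))"
    by (simp add: conv_def sum_distrib_right mult.assoc)
  also have "\<dots> = (\<Sum>x | c x \<noteq> 0. c x * (\<Sum>z\<in>F. d (z - x) * a (\<gamma> - z)))"
    by (subst sum.swap) (simp add: sum_distrib_left)
  also have "\<dots> = conv c (conv d a) \<gamma>"
    unfolding conv_def[of c] by (rule sum.cong) (auto simp: inner)
  finally show "conv (conv c d) a \<gamma> = conv c (conv d a) \<gamma>" .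
qed

definition has_t_sum :: "('g::ab_group_add \<Rightarrow> complex) \<Rightarrow> complex \<Rightarrow> bool" where
  "has_t_sum a S \<longleftrightarrow> (\<exists>c. finite {x. c x \<noteq> 0} \<and> total_mass c \<noteq> 0 \<and> (conv c a has_sum total_mass c * S) UNIV)"

lemma has_t_sum_iff:
  "has_t_sum a S \<longleftrightarrow> (\<exists>c. t_summing c a \<and> S = (\<Sum>\<^sub>\<infinity>\<gamma>. conv c a \<gamma>) / total_mass c)"
  unfolding has_t_sum_def t_summing_def abs_iff
  by (intro arg_cong[where f = Ex] ext)
     (auto simp: has_sum_infsum summable_iff_has_sum_infsum[symmetric]
       dest: infsumI has_sum_imp_summable)

lemma has_t_sum_unique:
  assumes "has_t_sum a S" "has_t_sum a T"
  shows "S = T"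
proof -
  obtain c d where c: "finite {x. c x \<noteq> 0}" "total_mass c \<noteq> 0" "(conv c a has_sum total_mass c * S) UNIV"
    and d: "finite {x. d x \<noteq> 0}" "total_mass d \<noteq> 0" "(conv d a has_sum total_mass d * T) UNIV"
    using assms unfolding has_t_sum_def by blast
  have "(conv d (conv c a) has_sum total_mass d * (total_mass c * S)) UNIV"
    by (intro has_sum_conv c d)
  moreover have "(conv d (conv c a) has_sum total_mass c * (total_mass d * T)) UNIV"
    unfolding conv_comm[of d] by (intro has_sum_conv c d)
  ultimately have "total_mass d * (total_mass c * S) = total_mass c * (total_mass d * T)" by (rule has_sum_unique)
  then show ?thesis using c d by simp
qed

theorem t_sum_eq:
  assumes "t_summing c a"
  shows "t_sum a = (\<Sum>\<^sub>\<infinity>\<gamma>. conv c a \<gamma>) / total_mass c"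
  unfolding t_sum_def has_t_sum_iff[symmetric]
  by (rule the_equality) (use assms has_t_sum_unique has_t_sum_iff in blast)+

lemma has_t_sum_t_sum: "t_summable a \<Longrightarrow> has_t_sum a (t_sum a)"
  unfolding t_summable_def has_t_sum_iff using t_sum_eq by blast

lemma has_t_sum_add:
  assumes "has_t_sum a S" "has_t_sum b T"
  shows "has_t_sum (\<lambda>x. a x + b x) (S + T)"
proof -
  obtain c d where c: "finite {x. c x \<noteq> 0}" "total_mass c \<noteq> 0" "(conv c a has_sum total_mass c * S) UNIV"
    and d: "finite {x. d x \<noteq> 0}" "total_mass d \<noteq> 0" "(conv d b has_sum total_mass d * T) UNIV"
    using assms unfolding has_t_sum_def by blast
  have "(conv (conv c d) a has_sum total_mass d * (total_mass c * S)) UNIV"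
    unfolding conv_assoc[OF c(1) d(1)] conv_comm[of c] by (intro has_sum_conv c d)
  moreover have "(conv (conv c d) b has_sum total_mass c * (total_mass d * T)) UNIV"
    unfolding conv_assoc[OF c(1) d(1)] by (intro has_sum_conv c d)
  ultimately have "((\<lambda>\<gamma>. conv (conv c d) a \<gamma> + conv (conv c d) b \<gamma>) has_sum
      total_mass d * (total_mass c * S) + total_mass c * (total_mass d * T)) UNIV"
    by (rule has_sum_add)
  moreover have "(\<lambda>\<gamma>. conv e a \<gamma> + conv e b \<gamma>) = conv e (\<lambda>x. a x + b x)" for e
    by (rule ext) (simp add: conv_def sum.distrib ring_distribs)
  ultimately have "(conv (conv c d) (\<lambda>x. a x + b x) has_sum total_mass (conv c d) * (S + T)) UNIV"
    by (simp add: total_mass_conv c d algebra_simps)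
  then show ?thesis unfolding has_t_sum_def
    using finite_supp_conv[OF c(1) d(1)] total_mass_conv[OF c(1) d(1)] c(2) d(2)
    by (intro exI[of _ "conv c d"]) auto
qed

lemma has_t_sum_cmult:
  assumes "has_t_sum a S"
  shows "has_t_sum (\<lambda>x. k * a x) (k * S)"
proof -
  obtain c where c: "finite {x. c x \<noteq> 0}" "total_mass c \<noteq> 0" "(conv c a has_sum total_mass c * S) UNIV"
    using assms unfolding has_t_sum_def by blast
  have "((\<lambda>\<gamma>. k * conv c a \<gamma>) has_sum k * (total_mass c * S)) UNIV"
    by (intro has_sum_cmult_right c)
  moreover have "(\<lambda>\<gamma>. k * conv c a \<gamma>) = conv c (\<lambda>x. k * a x)"
    by (rule ext) (simp add: conv_def sum_distrib_left mult_ac)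
  ultimately have "(conv c (\<lambda>x. k * a x) has_sum total_mass c * (k * S)) UNIV"
    by (simp add: mult_ac)
  then show ?thesis unfolding has_t_sum_def using c by blast
qed

lemma has_t_sum_zero: "has_t_sum (\<lambda>x::'g::ab_group_add. 0) 0"
proof -
  have "{x::'g. (if x = 0 then 1 else 0::complex) \<noteq> 0} = {0}" by auto
  then show ?thesis
    unfolding has_t_sum_def
    by (intro exI[of _ "\<lambda>x. if x = 0 then 1 else 0"])
       (simp add: total_mass_def conv_def[abs_def] has_sum_0)
qed

lemma has_t_sum_rho:
  fixes a :: "rat ^ 'k \<Rightarrow> complex"
  assumes "has_t_sum a S" "u \<noteq> 0"
  shows "has_t_sum (rho u a) S"
proof -
  obtain c where c: "finite {x. c x \<noteq> 0}" "total_mass c \<noteq> 0" "(conv c a has_sum total_mass c * S) UNIV"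
    using assms unfolding has_t_sum_def by blast
  have u: "u * inverse u = 1" "inverse u * u = 1" using assms(2) by simp_all
  have bij: "bij_betw (\<lambda>x::rat ^ 'k. inverse u *s x) UNIV UNIV"
    by (rule bij_betw_byWitness[where f' = "\<lambda>x. u *s x"]) (use u in auto)
  have inj: "inj_on (\<lambda>x::rat ^ 'k. u *s x) A" for A
    by (rule inj_on_inverseI[where g = "\<lambda>x. inverse u *s x"]) (use u in simp)
  have supp: "{x. rho u c x \<noteq> 0} = (\<lambda>x. u *s x) ` {x. c x \<noteq> 0}"
  proof (intro equalityI subsetI)
    fix x assume "x \<in> {x. rho u c x \<noteq> 0}"
    then show "x \<in> (\<lambda>x. u *s x) ` {x. c x \<noteq> 0}"
      by (intro image_eqI[of _ _ "inverse u *s x"]) (simp_all add: u rho_def)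
  qed (auto simp: rho_def u)
  have tot: "total_mass (rho u c) = total_mass c"
    unfolding total_mass_def supp by (subst sum.reindex[OF inj]) (simp add: rho_def u)
  have cv: "conv (rho u c) (rho u a) = (\<lambda>\<gamma>. conv c a (inverse u *s \<gamma>))"
    unfolding conv_def supp
    by (rule ext, subst sum.reindex[OF inj])
       (simp add: rho_def u vector_ssub_ldistrib)
  have "(conv (rho u c) (rho u a) has_sum total_mass c * S) UNIV"
    unfolding cv using has_sum_reindex_bij_betw[OF bij, of "conv c a" "total_mass c * S"] c(3) by simp
  then show ?thesis unfolding has_t_sum_def using c(1,2)
    by (intro exI[of _ "rho u c"]) (simp add: supp tot)
qed

lemma has_t_sum_sum:
  assumes "finite A" "\<And>t. t \<in> A \<Longrightarrow> has_t_sum (f t) (S t)"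
  shows "has_t_sum (\<lambda>x. \<Sum>t\<in>A. f t x) (\<Sum>t\<in>A. S t)"
  using assms by (induction A rule: finite_induct) (auto intro!: has_t_sum_add has_t_sum_zero)

lemma has_t_sum_rho_comb:
  fixes b :: "rat ^ 'k \<Rightarrow> complex"
  assumes "has_t_sum b S" "finite {t. d t \<noteq> 0}" "d 0 = 0"
  shows "has_t_sum (rho_comb d b) (total_mass d * S)"
proof -
  have "has_t_sum (\<lambda>x. \<Sum>t | d t \<noteq> 0. d t * rho t b x) (\<Sum>t | d t \<noteq> 0. d t * S)"
    by (intro has_t_sum_sum assms has_t_sum_cmult has_t_sum_rho) (use assms in auto)
  then show ?thesis by (simp add: rho_comb_def[abs_def] total_mass_def sum_distrib_right)
qed

lemma rho_comb_comm: "rho_comb d (rho_comb c a) = rho_comb c (rho_comb d a)"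
  by (rule ext) (simp add: rho_comb_def rho_def sum_distrib_left
      sum.swap[of _ "{x. c x \<noteq> 0}"] vector_smult_assoc mult_ac)

lemma h_sum_unique:
  fixes a :: "rat ^ 'k \<Rightarrow> complex"
  assumes c: "h_summing c a" and d: "h_summing d a"
  shows "t_sum (rho_comb c a) / total_mass c = t_sum (rho_comb d a) / total_mass d"
proof -
  have "has_t_sum (rho_comb d (rho_comb c a)) (total_mass d * t_sum (rho_comb c a))"
    by (intro has_t_sum_rho_comb has_t_sum_t_sum) (use c d in \<open>auto simp: h_summing_def\<close>)
  moreover have "has_t_sum (rho_comb d (rho_comb c a)) (total_mass c * t_sum (rho_comb d a))"
    unfolding rho_comb_comm[of d]
    by (intro has_t_sum_rho_comb has_t_sum_t_sum) (use c d in \<open>auto simp: h_summing_def\<close>)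
  ultimately have "total_mass d * t_sum (rho_comb c a) = total_mass c * t_sum (rho_comb d a)"
    by (rule has_t_sum_unique)
  then show ?thesis using c d by (simp add: h_summing_def field_simps)
qed

theorem h_sum_eq:
  assumes "h_summing c (zero_ext M a)"
  shows "h_sum a M = t_sum (rho_comb c (zero_ext M a)) / total_mass c"
  unfolding h_sum_def
  by (rule the_equality) (use assms h_sum_unique[OF _ assms] in blast)+

end

theory Submission
  imports Defs
begin

text \<open>
  Put \<open>F s x = f(x) powr (-s) * g(x)\<close>, homogeneous of degree \<open>\<sigma> = s0 - s\<close>, and let \<open>\<Lambda>\<close> be the integer lattice.
  Fix an integer \<open>N \<ge> 2\<close>. Subtracting \<open>N powr (\<sigma> + k)\<close> times the dilate by \<open>N\<close> turns the series into
  \<open>\<Sum> F s x * \<phi> x\<close>, where \<open>\<phi>\<close> is the indicator of \<open>\<Lambda>\<close> minus \<open>N ^ k\<close> times the indicator of \<open>N\<Lambda>\<close>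
  (\<open>rho_comb_dilation\<close>). The constant is chosen so that \<open>\<phi>\<close> has mean zero over every translate of the
  cube \<open>{0..<N}^k\<close>.

  Convolving \<open>F s * \<phi>\<close> with the indicator of that cube is summation by parts: because of the mean zero
  property, \<open>F s (x - v)\<close> may be replaced by the difference \<open>F s (x - v) - F s x\<close>. After \<open>m\<close>
  convolutions only \<open>m\<close>-fold differences of \<open>F s\<close> remain (\<open>conv_power_ind_eq_sum_iter_diff\<close>). By
  smoothness and homogeneity these are \<open>O(|x| powr (Re \<sigma> - m))\<close>, locally uniformly in \<open>s\<close>
  (\<open>iter_diff_decay\<close>). Hence, for large \<open>m\<close>, the convolved series converges absolutely and its sum
  \<open>H s\<close> is holomorphic on a half plane; the half planes exhaust the complex plane as \<open>m\<close> grows.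

  Dividing by the total masses, \<open>h s\<close> equals \<open>H s\<close> up to a nonzero constant over
  \<open>1 - N powr (k + s0 - s)\<close>, wherever this denominator is nonzero (\<open>h_eq\<close>). The denominators for
  \<open>N = 2\<close> and \<open>N = 3\<close> vanish together only at \<open>s = k + s0\<close>, as \<open>ln 2\<close> and \<open>ln 3\<close> are incommensurable,
  which gives summability and holomorphy elsewhere. At \<open>k + s0\<close> the denominator for \<open>N = 2\<close> has a
  simple zero, so the pole is at worst simple.
\<close>


section \<open>Smooth functions depending on a complex parameter\<close>

text \<open>The bounds on \<open>F s\<close> must be uniform for \<open>s\<close> in compact sets. Therefore each iterated
  directional derivative is required to be continuous in the parameter and the point jointly.
  Quantifying over a derivative \<open>D\<close>, instead of naming \<open>frechet_derivative\<close>, lets closure properties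
  be proved by exhibiting the derivative.\<close>

fun Ck_param :: "nat \<Rightarrow> (complex \<Rightarrow> 'a::real_normed_vector \<Rightarrow> complex) \<Rightarrow> 'a set \<Rightarrow> bool" where
  "Ck_param 0 G S \<longleftrightarrow> continuous_on (UNIV \<times> S) (\<lambda>(s, x). G s x)"
| "Ck_param (Suc n) G S \<longleftrightarrow> continuous_on (UNIV \<times> S) (\<lambda>(s, x). G s x) \<and>
     (\<exists>D. (\<forall>s. \<forall>x\<in>S. (G s has_derivative D s x) (at x)) \<and> (\<forall>v. Ck_param n (\<lambda>s x. D s x v) S))"

lemma Ck_param_continuous: "Ck_param n G S \<Longrightarrow> continuous_on (UNIV \<times> S) (\<lambda>(s, x). G s x)"
  by (cases n) auto

lemma Ck_param_SucI:
  assumes "continuous_on (UNIV \<times> S) (\<lambda>(s, x). G s x)"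
    "\<And>s x. x \<in> S \<Longrightarrow> (G s has_derivative D s x) (at x)" "\<And>v. Ck_param n (\<lambda>s x. D s x v) S"
  shows "Ck_param (Suc n) G S"
  using assms by auto

lemma Ck_param_Suc_imp: "Ck_param (Suc n) G S \<Longrightarrow> Ck_param n G S"
proof (induction n arbitrary: G)
  case (Suc n)
  from Suc.prems obtain D where
    "continuous_on (UNIV \<times> S) (\<lambda>(s, x). G s x)" "\<forall>s. \<forall>x\<in>S. (G s has_derivative D s x) (at x)"
    "\<forall>v. Ck_param (Suc n) (\<lambda>s x. D s x v) S"
    by auto
  then show ?case by (intro Ck_param_SucI[where D = D]) (blast intro: Suc.IH)+
qed auto

lemma Ck_param_cong:
  assumes "open S" "\<And>s x. x \<in> S \<Longrightarrow> G s x = H s x" "Ck_param n G S"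
  shows "Ck_param n H S"
proof -
  have *: "continuous_on (UNIV \<times> S) (\<lambda>(s, x). G s x) \<longleftrightarrow> continuous_on (UNIV \<times> S) (\<lambda>(s, x). H s x)"
    by (intro continuous_on_cong) (use assms(2) in auto)
  have "(H s has_derivative D) (at x)" if "(G s has_derivative D) (at x)" "x \<in> S" for s x D
    using has_derivative_transform_within_open[OF that(1) assms(1) that(2)] assms(2) by blast
  note deriv = this
  show ?thesis
  proof (cases n)
    case 0
    with assms(3) * show ?thesis by simp
  next
    case (Suc m)
    with assms(3) obtain D where "\<forall>s. \<forall>x\<in>S. (G s has_derivative D s x) (at x)"
      "\<forall>v. Ck_param m (\<lambda>s x. D s x v) S" by auto
    with deriv * Ck_param_continuous[OF assms(3)] show ?thesis
      unfolding Suc by (intro Ck_param_SucI[where D = D]) auto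
  qed
qed

lemma Ck_param_const:
  assumes "continuous_on UNIV c"
  shows "Ck_param n (\<lambda>s x. c s) S"
proof -
  have *: "continuous_on (UNIV \<times> S) (\<lambda>(s, x). d s)" if "continuous_on UNIV d" for d :: "complex \<Rightarrow> complex"
    unfolding case_prod_unfold
    by (rule continuous_on_compose2[OF that]) (auto intro!: continuous_intros)
  have zero: "Ck_param n (\<lambda>s x. 0) S" for n
  proof (induction n)
    case (Suc n)
    show ?case by (rule Ck_param_SucI[where D = "\<lambda>s x v. 0"]) (use Suc *[of "\<lambda>_. 0"] in auto)
  qed (use *[of "\<lambda>_. 0"] in auto)
  show ?thesis
  proof (cases n)
    case (Suc m)
    show ?thesis
      unfolding Suc by (rule Ck_param_SucI[where D = "\<lambda>s x v. 0"]) (use zero * assms in auto)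
  qed (use * assms in auto)
qed

lemma Ck_param_add:
  "Ck_param n G S \<Longrightarrow> Ck_param n H S \<Longrightarrow> Ck_param n (\<lambda>s x. G s x + H s x) S"
proof (induction n arbitrary: G H)
  case 0
  then show ?case by (auto simp: case_prod_unfold intro: continuous_on_add)
next
  case (Suc n)
  from Suc.prems obtain D where D: "\<forall>s. \<forall>x\<in>S. (G s has_derivative D s x) (at x)"
    "\<forall>v. Ck_param n (\<lambda>s x. D s x v) S" by auto
  from Suc.prems obtain E where E: "\<forall>s. \<forall>x\<in>S. (H s has_derivative E s x) (at x)"
    "\<forall>v. Ck_param n (\<lambda>s x. E s x v) S" by auto
  show ?case
  proof (rule Ck_param_SucI[where D = "\<lambda>s x v. D s x v + E s x v"])
    show "continuous_on (UNIV \<times> S) (\<lambda>(s, x). G s x + H s x)"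
      using Suc.prems by (auto simp: case_prod_unfold intro: continuous_on_add)
  qed (use D E Suc.IH in \<open>auto intro: has_derivative_add\<close>)
qed

lemma Ck_param_mult:
  "Ck_param n G S \<Longrightarrow> Ck_param n H S \<Longrightarrow> Ck_param n (\<lambda>s x. G s x * H s x) S"
proof (induction n arbitrary: G H)
  case 0
  then show ?case by (auto simp: case_prod_unfold intro: continuous_on_mult)
next
  case (Suc n)
  from Suc.prems obtain D where D: "\<forall>s. \<forall>x\<in>S. (G s has_derivative D s x) (at x)"
    "\<forall>v. Ck_param n (\<lambda>s x. D s x v) S" by auto
  from Suc.prems obtain E where E: "\<forall>s. \<forall>x\<in>S. (H s has_derivative E s x) (at x)"
    "\<forall>v. Ck_param n (\<lambda>s x. E s x v) S" by auto
  show ?case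
  proof (rule Ck_param_SucI[where D = "\<lambda>s x v. G s x * E s x v + D s x v * H s x"])
    show "continuous_on (UNIV \<times> S) (\<lambda>(s, x). G s x * H s x)"
      using Suc.prems by (auto simp: case_prod_unfold intro: continuous_on_mult)
    show "Ck_param n (\<lambda>s x. G s x * E s x v + D s x v * H s x) S" for v
      using Suc.prems[THEN Ck_param_Suc_imp] D E by (intro Ck_param_add Suc.IH) auto
  qed (use D E in \<open>auto intro: has_derivative_mult\<close>)
qed

lemma Ck_on_imp_Ck_param:
  fixes g :: "'a::real_normed_vector \<Rightarrow> complex"
  shows "Ck_on n g S \<Longrightarrow> Ck_param n (\<lambda>s. g) S"
proof (induction n arbitrary: g)
  case 0
  have "continuous_on (UNIV \<times> S) (\<lambda>p. g (snd p))"
    by (rule continuous_on_compose2[of S g]) (use 0 in \<open>auto intro!: continuous_intros\<close>)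
  then show ?case by (simp add: case_prod_unfold)
next
  case (Suc n)
  have "continuous_on S g"
    using Suc.prems by (auto intro!: continuous_at_imp_continuous_on differentiable_imp_continuous_within)
  then have "continuous_on (UNIV \<times> S) (\<lambda>p. g (snd p))"
    by (rule continuous_on_compose2) (auto intro!: continuous_intros)
  then show ?case
    using Suc by (intro Ck_param_SucI[where D = "\<lambda>s x. frechet_derivative g (at x)"])
       (auto simp: case_prod_unfold frechet_derivative_works)
qed

text \<open>Differentiating \<open>f powr -(s + c)\<close> produces a factor \<open>f powr -(s + c + 1)\<close>; the shift \<open>c\<close> is
  there so that the induction hypothesis applies to it.\<close>

lemma Ck_param_powr:
  fixes f :: "'a::real_normed_vector \<Rightarrow> complex"
  assumes "smooth_on f S" "\<And>x. x \<in> S \<Longrightarrow> f x \<in> \<real> \<and> 0 < Re (f x)"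
  shows "Ck_param n (\<lambda>s x. f x powr (- (s + c))) S"
proof (induction n arbitrary: c)
  case 0
  have "Ck_on 0 f S" using assms(1) by (simp only: smooth_on_def)
  from Ck_param_continuous[OF Ck_on_imp_Ck_param[OF this]]
  have "continuous_on ((UNIV :: complex set) \<times> S) (\<lambda>p. f (snd p))" by (simp only: case_prod_unfold)
  then have "continuous_on (UNIV \<times> S) (\<lambda>(s, x). f x powr (- (s + c)))" for c
    unfolding case_prod_unfold
    by (intro continuous_on_powr_complex continuous_intros) (use assms(2) in force)+
  then show ?case by simp
next
  case (Suc n)
  have Ck: "Ck_on m f S" for m using assms(1) by (simp add: smooth_on_def)
  have D: "(f has_derivative frechet_derivative f (at x)) (at x)" if "x \<in> S" for x
    using Ck[of 1] that by (simp add: frechet_derivative_works)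
  show ?case
  proof (rule Ck_param_SucI[where D = "\<lambda>s x v. - (s + c) * (f x powr (- (s + (c + 1))) * frechet_derivative f (at x) v)"])
    show "continuous_on (UNIV \<times> S) (\<lambda>(s, x). f x powr (- (s + c)))"
      using Suc.IH[of c] by (rule Ck_param_continuous)
    show "((\<lambda>x. f x powr (- (s + c))) has_derivative
        (\<lambda>v. - (s + c) * (f x powr (- (s + (c + 1))) * frechet_derivative f (at x) v))) (at x)"
      if "x \<in> S" for s x
    proof -
      have "f x \<notin> \<real>\<^sub>\<le>\<^sub>0" using assms(2)[OF that] by (auto simp: complex_nonpos_Reals_iff)
      from has_derivative_compose[OF D[OF that]
          has_field_derivative_powr[OF this, of "- (s + c)", unfolded has_field_derivative_def]]
      show ?thesis by (simp add: mult_ac diff_diff_eq add_ac)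
    qed
    show "Ck_param n (\<lambda>s x. - (s + c) * (f x powr (- (s + (c + 1))) * frechet_derivative f (at x) v)) S" for v
    proof (intro Ck_param_mult Suc.IH)
      show "Ck_param n (\<lambda>s x. - (s + c)) S" by (rule Ck_param_const) (intro continuous_intros)
      show "Ck_param n (\<lambda>s x. frechet_derivative f (at x) v) S"
        using Ck[of "Suc n"] by (intro Ck_on_imp_Ck_param) simp
    qed
  qed
qed

section \<open>Iterated differences of homogeneous functions\<close>

fun iter_diff :: "'a::ab_group_add list \<Rightarrow> ('a \<Rightarrow> 'b::ab_group_add) \<Rightarrow> 'a \<Rightarrow> 'b" where
  "iter_diff [] G x = G x"
| "iter_diff (v # vs) G x = iter_diff vs G (x - v) - iter_diff vs G x"

lemma iter_diff_Nil: "iter_diff [] G = G"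
  and iter_diff_Cons: "iter_diff (v # vs) G = (\<lambda>x. iter_diff vs G (x - v) - iter_diff vs G x)"
  by auto

lemma iter_diff_has_derivative:
  fixes G :: "'a::real_normed_vector \<Rightarrow> 'b::real_normed_vector"
  assumes "\<And>y. dist x y \<le> sum_list (map norm vs) \<Longrightarrow> (G has_derivative D y) (at y)"
  shows "(iter_diff vs G has_derivative (\<lambda>h. iter_diff vs (\<lambda>y. D y h) x)) (at x)"
  using assms
proof (induction vs arbitrary: x)
  case (Cons v vs)
  have "(iter_diff vs G has_derivative (\<lambda>h. iter_diff vs (\<lambda>y. D y h) (x - v))) (at (x - v))"
  proof (rule Cons.IH)
    fix y assume "dist (x - v) y \<le> sum_list (map norm vs)"
    then show "(G has_derivative D y) (at y)"
      using dist_triangle[of x y "x - v"] by (intro Cons.prems) (simp add: dist_norm)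
  qed
  moreover have "((\<lambda>x. x - v) has_derivative (\<lambda>h. h)) (at x)" by (auto intro!: derivative_eq_intros)
  ultimately have "((\<lambda>x. iter_diff vs G (x - v)) has_derivative (\<lambda>h. iter_diff vs (\<lambda>y. D y h) (x - v))) (at x)"
    using has_derivative_compose by fastforce
  moreover have "(iter_diff vs G has_derivative (\<lambda>h. iter_diff vs (\<lambda>y. D y h) x)) (at x)"
  proof (rule Cons.IH)
    fix y assume "dist x y \<le> sum_list (map norm vs)"
    then show "(G has_derivative D y) (at y)" by (intro Cons.prems) (simp add: add_increasing)
  qed
  ultimately have "((\<lambda>x. iter_diff vs G (x - v) - iter_diff vs G x) has_derivative
      (\<lambda>h. iter_diff vs (\<lambda>y. D y h) (x - v) - iter_diff vs (\<lambda>y. D y h) x)) (at x)"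
    by (rule has_derivative_diff)
  then show ?case by (simp add: iter_diff_Cons)
qed (simp add: iter_diff_Nil)

lemma sum_list_norm_scaleR:
  fixes vs :: "'a::real_normed_vector list"
  assumes "0 \<le> \<epsilon>"
  shows "sum_list (map norm (map ((*\<^sub>R) \<epsilon>) vs)) = \<epsilon> * sum_list (map norm vs)"
  using assms by (induction vs) (auto simp: algebra_simps)

text \<open>The mean value theorem, used once for each direction in \<open>vs\<close>, compares an iterated difference
  with an iterated directional derivative. The directions stay fixed and only the factor \<open>\<epsilon>\<close> shrinks,
  so one constant serves all \<open>\<epsilon>\<close>; the ball hypothesis keeps every point that enters the difference
  inside a compact set, where the derivatives are bounded.\<close>

lemma iter_diff_bound:
  fixes G :: "complex \<Rightarrow> 'a::real_normed_vector \<Rightarrow> complex"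
  assumes "compact K" "compact X" "X \<subseteq> S" "Ck_param (length vs) G S"
  shows "\<exists>C\<ge>0. \<forall>s\<in>K. \<forall>x. \<forall>\<epsilon>\<ge>0. cball x (\<epsilon> * sum_list (map norm vs)) \<subseteq> X \<longrightarrow>
           norm (iter_diff (map ((*\<^sub>R) \<epsilon>) vs) (G s) x) \<le> C * \<epsilon> ^ length vs"
  using assms(4)
proof (induction vs arbitrary: G)
  case Nil
  have "compact ((\<lambda>(s, x). G s x) ` (K \<times> X))"
  proof (rule compact_continuous_image)
    show "continuous_on (K \<times> X) (\<lambda>(s, x). G s x)"
      by (rule continuous_on_subset[of "UNIV \<times> S"]) (use Nil assms(3) in auto)
  qed (use assms in \<open>auto intro: compact_Times\<close>)
  then obtain B where "0 < B" "\<And>z. z \<in> (\<lambda>(s, x). G s x) ` (K \<times> X) \<Longrightarrow> norm z \<le> B"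
    using compact_imp_bounded bounded_pos by metis
  then show ?case by (intro exI[of _ B]) fastforce
next
  case (Cons v vs)
  from Cons.prems obtain D where D: "\<And>s x. x \<in> S \<Longrightarrow> (G s has_derivative D s x) (at x)"
    "\<And>v. Ck_param (length vs) (\<lambda>s x. D s x v) S" by auto
  define L where "L = sum_list (map norm vs)"
  have L0: "0 \<le> L" unfolding L_def by (intro sum_list_nonneg) auto
  obtain C where C: "0 \<le> C" "\<And>s x \<epsilon>. s \<in> K \<Longrightarrow> 0 \<le> \<epsilon> \<Longrightarrow> cball x (\<epsilon> * L) \<subseteq> X \<Longrightarrow>
           norm (iter_diff (map ((*\<^sub>R) \<epsilon>) vs) (\<lambda>y. D s y v) x) \<le> C * \<epsilon> ^ length vs"
    using Cons.IH[OF D(2)[of v]] unfolding L_def by metis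
  have "norm (iter_diff (map ((*\<^sub>R) \<epsilon>) (v # vs)) (G s) x) \<le> C * \<epsilon> ^ length (v # vs)"
    if s: "s \<in> K" and \<epsilon>: "0 \<le> \<epsilon>" and sub: "cball x (\<epsilon> * sum_list (map norm (v # vs))) \<subseteq> X" for s x \<epsilon>
  proof -
    \<comment> \<open>the difference in direction \<open>v\<close> is the increment of \<open>\<phi>\<close> from \<open>0\<close> to \<open>\<epsilon>\<close>\<close>
    define \<phi> where "\<phi> \<tau> = iter_diff (map ((*\<^sub>R) \<epsilon>) vs) (G s) (x - \<tau> *\<^sub>R v)" for \<tau>
    have in_X: "cball (x - \<tau> *\<^sub>R v) (\<epsilon> * L) \<subseteq> X" if "\<tau> \<in> {0..\<epsilon>}" for \<tau>
    proof (rule order_trans[OF _ sub], rule subsetI)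
      fix y assume y: "y \<in> cball (x - \<tau> *\<^sub>R v) (\<epsilon> * L)"
      have "dist x (x - \<tau> *\<^sub>R v) \<le> \<epsilon> * norm v"
        using that by (auto simp: dist_norm intro: mult_right_mono)
      with y show "y \<in> cball x (\<epsilon> * sum_list (map norm (v # vs)))"
        using dist_triangle[of x y "x - \<tau> *\<^sub>R v"] by (simp add: L_def algebra_simps)
    qed
    define d where "d \<tau> h = iter_diff (map ((*\<^sub>R) \<epsilon>) vs) (\<lambda>y. D s y h) (x - \<tau> *\<^sub>R v)" for \<tau> h
    have d: "(iter_diff (map ((*\<^sub>R) \<epsilon>) vs) (G s) has_derivative d \<tau>) (at (x - \<tau> *\<^sub>R v))"
      if "\<tau> \<in> {0..\<epsilon>}" for \<tau>
      unfolding d_def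
    proof (rule iter_diff_has_derivative)
      fix y assume "dist (x - \<tau> *\<^sub>R v) y \<le> sum_list (map norm (map ((*\<^sub>R) \<epsilon>) vs))"
      then have "y \<in> cball (x - \<tau> *\<^sub>R v) (\<epsilon> * L)"
        using sum_list_norm_scaleR[OF \<epsilon>, of vs] by (simp add: L_def)
      with in_X[OF that] assms(3) show "(G s has_derivative D s y) (at y)" by (intro D) auto
    qed
    have "norm (\<phi> \<epsilon> - \<phi> 0) \<le> (C * \<epsilon> ^ length vs) * norm (\<epsilon> - 0)"
    proof (rule differentiable_bound[where S = "{0..\<epsilon>}" and f' = "\<lambda>\<tau> t. d \<tau> (- (t *\<^sub>R v))"])
      fix \<tau> assume \<tau>: "\<tau> \<in> {0..\<epsilon>}"
      have "((\<lambda>\<tau>. x - \<tau> *\<^sub>R v) has_derivative (\<lambda>t. - (t *\<^sub>R v))) (at \<tau> within {0..\<epsilon>})"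
        by (auto intro!: derivative_eq_intros)
      from has_derivative_compose[OF this d[OF \<tau>]]
      show "(\<phi> has_derivative (\<lambda>t. d \<tau> (- (t *\<^sub>R v)))) (at \<tau> within {0..\<epsilon>})"
        by (simp add: \<phi>_def[abs_def])
      interpret bounded_linear "d \<tau>" using d[OF \<tau>] by (rule has_derivative_bounded_linear)
      have "norm (d \<tau> v) \<le> C * \<epsilon> ^ length vs"
        unfolding d_def using s \<epsilon> in_X[OF \<tau>] by (intro C)
      then show "onorm (\<lambda>t. d \<tau> (- (t *\<^sub>R v))) \<le> C * \<epsilon> ^ length vs"
        using C(1) \<epsilon> by (intro onorm_bound)
          (auto simp: scaleR neg mult.commute[of _ "\<bar>_\<bar>"] intro: mult_left_mono)
    qed (use \<epsilon> in auto)
    then show ?thesis using \<epsilon> by (simp add: \<phi>_def mult_ac)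
  qed
  with C(1) show ?case by blast
qed

lemma iter_diff_scale:
  fixes G :: "'a::real_normed_vector \<Rightarrow> 'b::ring"
  assumes "\<And>z. z \<noteq> 0 \<Longrightarrow> G (r *\<^sub>R z) = \<mu> * G z" "sum_list (map norm vs) < norm y"
  shows "iter_diff (map ((*\<^sub>R) r) vs) G (r *\<^sub>R y) = \<mu> * iter_diff vs G y"
  using assms(2)
proof (induction vs arbitrary: y)
  case Nil
  then show ?case using assms(1)[of y] by auto
next
  case (Cons v vs)
  have "sum_list (map norm vs) < norm (y - v)"
    using Cons.prems norm_triangle_ineq2[of y v] by simp
  moreover have "sum_list (map norm vs) < norm y"
    using Cons.prems norm_ge_zero[of v] by (simp del: norm_ge_zero)
  ultimately show ?case
    using Cons.IH[of "y - v"] Cons.IH[of y] by (simp add: algebra_simps)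
qed

text \<open>A difference with steps \<open>vs\<close> at a far point \<open>y\<close> is, by homogeneity, \<open>norm y powr \<sigma>\<close> times a
  difference with steps \<open>vs / norm y\<close> at a point of the unit sphere. The steps have become small, and
  each contributes a factor \<open>1 / norm y\<close>. The lower bound on \<open>norm y\<close> keeps all points of the scaled
  difference at distance at least \<open>1/2\<close> from the singularity at the origin.\<close>

lemma iter_diff_decay:
  fixes G :: "complex \<Rightarrow> 'a::euclidean_space \<Rightarrow> complex"
  assumes "compact K" "Ck_param (length vs) G (- {0})"
    and hom: "\<And>s t x. 0 < t \<Longrightarrow> x \<noteq> 0 \<Longrightarrow> G s (t *\<^sub>R x) = complex_of_real t powr (\<sigma> s) * G s x"
  shows "\<exists>C\<ge>0. \<forall>s\<in>K. \<forall>y. y \<noteq> 0 \<longrightarrow> 2 * sum_list (map norm vs) \<le> norm y \<longrightarrow>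
           norm (iter_diff vs (G s) y) \<le> C * norm y powr (Re (\<sigma> s) - length vs)"
proof -
  define X where "X = cball (0::'a) (3/2) - ball 0 (1/2)"
  have X: "compact X" "X \<subseteq> - {0}" unfolding X_def by (auto intro: compact_diff)
  define L where "L = sum_list (map norm vs)"
  have L0: "0 \<le> L" unfolding L_def by (intro sum_list_nonneg) auto
  obtain C where C: "0 \<le> C" "\<And>s x \<epsilon>. s \<in> K \<Longrightarrow> 0 \<le> \<epsilon> \<Longrightarrow> cball x (\<epsilon> * L) \<subseteq> X \<Longrightarrow>
           norm (iter_diff (map ((*\<^sub>R) \<epsilon>) vs) (G s) x) \<le> C * \<epsilon> ^ length vs"
    using iter_diff_bound[OF assms(1) X assms(2)] unfolding L_def by metis
  have "norm (iter_diff vs (G s) y) \<le> C * norm y powr (Re (\<sigma> s) - length vs)"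
    if s: "s \<in> K" and y: "y \<noteq> 0" "2 * L \<le> norm y" for s y
  proof -
    \<comment> \<open>rescaling by \<open>\<epsilon>\<close> moves \<open>y\<close> to the unit sphere\<close>
    define \<epsilon> where "\<epsilon> = inverse (norm y)"
    have \<epsilon>: "0 < \<epsilon>" using y by (simp add: \<epsilon>_def)
    have \<epsilon>L: "\<epsilon> * L \<le> 1/2" using y by (simp add: \<epsilon>_def field_simps)
    have "cball (\<epsilon> *\<^sub>R y) (\<epsilon> * L) \<subseteq> X"
    proof
      fix z assume z: "z \<in> cball (\<epsilon> *\<^sub>R y) (\<epsilon> * L)"
      have "norm (\<epsilon> *\<^sub>R y) = 1" using y by (simp add: \<epsilon>_def)
      with z \<epsilon>L show "z \<in> X"
        using norm_triangle_ineq2[of z "\<epsilon> *\<^sub>R y"] norm_triangle_ineq2[of "\<epsilon> *\<^sub>R y" z]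
        by (auto simp: X_def dist_norm norm_minus_commute)
    qed
    then have "norm (iter_diff (map ((*\<^sub>R) \<epsilon>) vs) (G s) (\<epsilon> *\<^sub>R y)) \<le> C * \<epsilon> ^ length vs"
      using C(2)[OF s] \<epsilon> by simp
    moreover have "iter_diff (map ((*\<^sub>R) \<epsilon>) vs) (G s) (\<epsilon> *\<^sub>R y) = complex_of_real \<epsilon> powr (\<sigma> s) * iter_diff vs (G s) y"
    proof (rule iter_diff_scale)
      show "sum_list (map norm vs) < norm y"
        using y L0 zero_less_norm_iff[of y] unfolding L_def[symmetric] by linarith
    qed (use \<epsilon> hom in auto)
    ultimately have "\<epsilon> powr Re (\<sigma> s) * norm (iter_diff vs (G s) y) \<le> C * \<epsilon> ^ length vs"
      using \<epsilon> by (simp add: norm_mult norm_powr_real_powr)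
    moreover have "\<epsilon> powr Re (\<sigma> s) = inverse (norm y powr Re (\<sigma> s))"
      using y by (simp add: \<epsilon>_def powr_def ln_inverse exp_minus)
    moreover have "\<epsilon> ^ length vs = inverse (norm y powr length vs)"
      using y by (simp add: \<epsilon>_def powr_realpow power_inverse)
    ultimately show ?thesis
      using y by (simp add: powr_diff field_simps)
  qed
  with C(1) show ?thesis unfolding L_def by blast
qed



section \<open>Sums over the integer lattice\<close>

definition vecs_in :: "'a set \<Rightarrow> ('a ^ 'k) set" where
  "vecs_in A = {x. \<forall>i. x $ i \<in> A}"

lemma bij_betw_vecs_in: "bij_betw vec_nth (vecs_in A :: ('a ^ 'k) set) (UNIV \<rightarrow>\<^sub>E A)"
  by (rule bij_betw_byWitness[where f' = vec_lambda]) (auto simp: vecs_in_def)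

lemma finite_vecs_in: "finite A \<Longrightarrow> finite (vecs_in A :: ('a ^ 'k) set)"
  using bij_betw_finite[OF bij_betw_vecs_in[of A]] by (simp add: finite_PiE)

lemma sum_vecs_in:
  fixes w :: "'a \<Rightarrow> 'b::comm_semiring_1"
  assumes "finite A"
  shows "(\<Sum>x\<in>(vecs_in A :: ('a ^ 'k) set). \<Prod>i\<in>UNIV. w (x $ i)) = (\<Sum>a\<in>A. w a) ^ CARD('k)"
proof -
  have "(\<Sum>x\<in>(vecs_in A :: ('a ^ 'k) set). \<Prod>i\<in>UNIV. w (x $ i)) = (\<Sum>p\<in>UNIV \<rightarrow>\<^sub>E A. \<Prod>i\<in>(UNIV::'k set). w (p i))"
    by (rule sum.reindex_bij_betw[OF bij_betw_vecs_in])
  also have "\<dots> = (\<Prod>i\<in>(UNIV::'k set). \<Sum>a\<in>A. w a)"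
    by (rule prod_sum_PiE[symmetric]) (use assms in auto)
  finally show ?thesis by simp
qed

lemma card_vecs_in: "finite A \<Longrightarrow> card (vecs_in A :: ('a ^ 'k) set) = card A ^ CARD('k)"
  using sum_vecs_in[of A "\<lambda>_. 1::nat", where 'k = 'k] by simp

lemma int_lattice_diff: "x \<in> int_lattice \<Longrightarrow> y \<in> int_lattice \<Longrightarrow> x - y \<in> int_lattice"
  by (auto simp: int_lattice_def)

lemma int_lattice_add: "x \<in> int_lattice \<Longrightarrow> y \<in> int_lattice \<Longrightarrow> x + y \<in> int_lattice"
  by (auto simp: int_lattice_def)

lemma real_vec_simps [simp]:
  "real_vec 0 = 0" "real_vec (x - y) = real_vec x - real_vec y" "real_vec x = 0 \<longleftrightarrow> x = 0"
  "real_vec (r *s x) = of_rat r *\<^sub>R real_vec x"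
  by (auto simp: real_vec_def vec_eq_iff of_rat_diff of_rat_mult)

lemma norm_real_vec_ge_1:
  assumes "x \<in> int_lattice" "x \<noteq> 0"
  shows "1 \<le> norm (real_vec x)"
proof -
  obtain i where i: "x $ i \<noteq> 0" using assms(2) by (auto simp: vec_eq_iff)
  obtain n where n: "x $ i = of_int n" using assms(1) by (auto simp: int_lattice_def elim: Ints_cases)
  have "1 \<le> \<bar>n\<bar>" using i n by auto
  then have "1 \<le> \<bar>real_of_int n\<bar>" by linarith
  also have "real_of_int n = real_vec x $ i" using n by (simp add: real_vec_def)
  also have "\<bar>real_vec x $ i\<bar> \<le> norm (real_vec x)" by (rule component_le_norm_cart)
  finally show ?thesis .
qed

lemma finite_lattice_ball: "finite {x \<in> int_lattice. norm (real_vec (x :: rat ^ 'k)) \<le> R}"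
proof (rule finite_subset)
  define A where "A = {r :: rat. r \<in> \<int> \<and> \<bar>real_of_rat r\<bar> \<le> R}"
  have "A \<subseteq> of_int ` {-\<lceil>R\<rceil>..\<lceil>R\<rceil>}"
  proof
    fix r assume "r \<in> A"
    then obtain n where n: "r = of_int n" and "\<bar>real_of_rat r\<bar> \<le> R" by (auto simp: A_def simp del: abs_of_rat elim!: Ints_cases)
    moreover have "real_of_rat r = real_of_int n" using n by simp
    ultimately have "\<bar>real_of_int n\<bar> \<le> R" by metis
    then have "n \<in> {-\<lceil>R\<rceil>..\<lceil>R\<rceil>}" by auto linarith+
    then show "r \<in> of_int ` {-\<lceil>R\<rceil>..\<lceil>R\<rceil>}" by (rule image_eqI[where f = of_int, OF n])
  qed
  then have "finite A" by (rule finite_subset) simp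
  then show "finite (vecs_in A :: (rat ^ 'k) set)" by (rule finite_vecs_in)
  show "{x \<in> int_lattice. norm (real_vec (x :: rat ^ 'k)) \<le> R} \<subseteq> vecs_in A"
  proof safe
    fix x :: "rat ^ 'k" assume x: "x \<in> int_lattice" "norm (real_vec x) \<le> R"
    have "\<bar>real_of_rat (x $ i)\<bar> \<le> R" for i
      using component_le_norm_cart[of "real_vec x" i] x(2) by (simp add: real_vec_def)
    with x(1) show "x \<in> vecs_in A" by (auto simp: vecs_in_def A_def int_lattice_def)
  qed
qed

text \<open>A majorant that is summable over the lattice because it is a product of one-dimensional
  weights. It only dominates exponents up to \<open>-2k\<close>, short of the critical \<open>-k\<close>,
  but this is enough since the number of differences can be raised at will.\<close>

definition lattice_weight :: "rat ^ 'k \<Rightarrow> real" where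
  "lattice_weight x = (\<Prod>i\<in>UNIV. 1 / (1 + (real_of_rat (x $ i))\<^sup>2))"

lemma summable_on_Ints_weight: "(\<lambda>r :: rat. 1 / (1 + (real_of_rat r)\<^sup>2)) summable_on \<int>"
proof -
  define w where "w r = 1 / (1 + (real_of_rat r)\<^sup>2)" for r
  have *: "summable (\<lambda>n. 1 / (1 + (real n)\<^sup>2))"
  proof (rule summable_comparison_test'[where N = 1])
    show "summable (\<lambda>n. inverse (real n ^ 2))" by (rule inverse_power_summable) simp
  next
    fix n :: nat
    have "0 < 1 + (real n)\<^sup>2" by (simp add: add_pos_nonneg)
    then show "1 \<le> n \<Longrightarrow> norm (1 / (1 + (real n)\<^sup>2)) \<le> inverse (real n ^ 2)"
      by (simp add: divide_simps)
  qed
  have nat: "(\<lambda>n. 1 / (1 + (real n)\<^sup>2)) summable_on UNIV"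
    by (rule norm_summable_imp_summable_on) (use * in simp)
  have "w summable_on range (of_nat :: nat \<Rightarrow> rat)"
    by (subst summable_on_reindex) (use nat in \<open>auto simp: w_def o_def inj_on_def\<close>)
  moreover have "w summable_on range (\<lambda>n :: nat. - of_nat n :: rat)"
    by (subst summable_on_reindex) (use nat in \<open>auto simp: w_def o_def inj_on_def of_rat_minus\<close>)
  ultimately have "w summable_on (range of_nat \<union> range (\<lambda>n :: nat. - of_nat n))"
    by (rule summable_on_union)
  moreover have "\<int> \<subseteq> range of_nat \<union> range (\<lambda>n :: nat. - of_nat n :: rat)"
  proof
    fix r :: rat assume "r \<in> \<int>"
    then obtain n where "r = of_int n" by (rule Ints_cases)
    then show "r \<in> range of_nat \<union> range (\<lambda>n :: nat. - of_nat n :: rat)" by (cases n rule: int_cases2) auto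
  qed
  ultimately show ?thesis unfolding w_def by (rule summable_on_subset_banach)
qed

text \<open>A finite part of the lattice lies in \<open>A ^ k\<close> for the finite set \<open>A\<close> of all its coordinates,
  and over \<open>A ^ k\<close> the sum factorises.\<close>

lemma summable_on_lattice_weight: "(lattice_weight :: rat ^ 'k \<Rightarrow> real) summable_on int_lattice"
proof -
  define w where "w r = 1 / (1 + (real_of_rat r)\<^sup>2)" for r
  define C where "C = infsum w \<int>"
  have w0: "0 \<le> w r" for r by (simp add: w_def)
  have sumw: "sum w A \<le> C" if "finite A" "A \<subseteq> \<int>" for A
    unfolding C_def by (rule finite_sum_le_infsum)
      (use that w0 summable_on_Ints_weight in \<open>auto simp: w_def[abs_def]\<close>)
  have bound: "sum lattice_weight Y \<le> C ^ CARD('k)" if Y: "finite Y" "Y \<subseteq> int_lattice" for Y :: "(rat ^ 'k) set"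
  proof -
    define A where "A = (\<lambda>(x, i). x $ i) ` (Y \<times> UNIV)"
    have A: "finite A" "A \<subseteq> \<int>" using Y by (auto simp: A_def int_lattice_def)
    have "Y \<subseteq> vecs_in A" by (auto simp: vecs_in_def A_def)
    then have "sum lattice_weight Y \<le> sum lattice_weight (vecs_in A :: (rat ^ 'k) set)"
      by (intro sum_mono2 finite_vecs_in A) (auto simp: lattice_weight_def intro: prod_nonneg)
    also have "\<dots> = sum w A ^ CARD('k)"
      unfolding lattice_weight_def w_def using A(1) by (rule sum_vecs_in)
    also have "\<dots> \<le> C ^ CARD('k)"
      using A sumw by (intro power_mono) (auto intro: sum_nonneg w0)
    finally show ?thesis .
  qed
  show ?thesis
  proof (rule nonneg_bounded_partial_sums_imp_summable_on)
    show "\<forall>\<^sub>F Y in finite_subsets_at_top (int_lattice :: (rat ^ 'k) set). sum lattice_weight Y \<le> C ^ CARD('k)"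
      by (rule eventually_finite_subsets_at_top_weakI) (use bound in auto)
  qed (auto simp: lattice_weight_def intro: prod_nonneg)
qed

lemma norm_powr_le_lattice_weight:
  fixes x :: "rat ^ 'k"
  assumes "x \<in> int_lattice" "x \<noteq> 0" "p \<le> - 2 * real CARD('k)"
  shows "norm (real_vec x) powr p \<le> 2 ^ CARD('k) * lattice_weight x"
proof -
  define r where "r = norm (real_vec x)"
  have r: "1 \<le> r" unfolding r_def by (rule norm_real_vec_ge_1) fact+
  have "r powr p \<le> r powr (- 2 * real CARD('k))" using r assms(3) by (rule powr_mono[rotated])
  also have "\<dots> = (1 / r\<^sup>2) ^ CARD('k)"
  proof -
    have "r powr (- 2 * real CARD('k)) = inverse (r powr real (2 * CARD('k)))"
      by (simp add: powr_minus[symmetric])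
    also have "r powr real (2 * CARD('k)) = r ^ (2 * CARD('k))" using r by (subst powr_realpow) auto
    finally show ?thesis by (simp add: power_mult power_inverse divide_inverse)
  qed
  also have "\<dots> = (\<Prod>i\<in>(UNIV::'k set). 1 / r\<^sup>2)" by simp
  also have "\<dots> \<le> (\<Prod>i\<in>(UNIV::'k set). 2 * (1 / (1 + (real_of_rat (x $ i))\<^sup>2)))"
  proof (rule prod_mono, safe)
    fix i
    have "\<bar>real_of_rat (x $ i)\<bar> \<le> r"
      using component_le_norm_cart[of "real_vec x" i] by (simp add: real_vec_def r_def del: abs_of_rat)
    then have "(real_of_rat (x $ i))\<^sup>2 \<le> r\<^sup>2" using power_mono[of "\<bar>real_of_rat (x $ i)\<bar>" r 2] by (simp del: abs_of_rat)
    moreover have "1 \<le> r\<^sup>2" using r by simp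
    moreover have "0 < 1 + (real_of_rat (x $ i))\<^sup>2" by (simp add: add_pos_nonneg)
    ultimately show "1 / r\<^sup>2 \<le> 2 * (1 / (1 + (real_of_rat (x $ i))\<^sup>2))"
      by (simp add: divide_simps)
  qed simp
  also have "\<dots> = 2 ^ CARD('k) * lattice_weight x"
    unfolding lattice_weight_def prod.distrib by simp
  finally show ?thesis by (simp add: r_def)
qed

section \<open>A mean zero function on the lattice\<close>

definition cube :: "nat \<Rightarrow> (rat ^ 'k) set" where
  "cube N = vecs_in (of_nat ` {..<N})"

lemma finite_cube: "finite (cube N)"
  unfolding cube_def by (intro finite_vecs_in) simp

lemma card_cube: "card (cube N :: (rat ^ 'k) set) = N ^ CARD('k)"
  unfolding cube_def by (subst card_vecs_in) (auto simp: card_image inj_on_def)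

lemma cube_subset: "(cube N :: (rat ^ 'k) set) \<subseteq> int_lattice"
proof
  fix x :: "rat ^ 'k" assume "x \<in> cube N"
  then have "x $ i \<in> of_nat ` {..<N}" for i by (simp add: cube_def vecs_in_def)
  then have "x $ i \<in> \<int>" for i by (metis Ints_of_nat imageE)
  then show "x \<in> int_lattice" by (simp add: int_lattice_def)
qed

definition balanced :: "nat \<Rightarrow> rat ^ 'k \<Rightarrow> complex" where
  "balanced N x = (if x \<in> int_lattice then 1 else 0) -
     of_nat (N ^ CARD('k)) * (if inverse (of_nat N) *s x \<in> int_lattice then 1 else 0)"

lemma scaled_lattice_imp:
  fixes x :: "rat ^ 'k"
  assumes "0 < N" "inverse (of_nat N) *s x \<in> int_lattice"
  shows "x \<in> int_lattice"
proof -
  have "x $ i \<in> \<int>" for i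
  proof -
    have "inverse (of_nat N) * x $ i \<in> \<int>" using assms(2) by (simp add: int_lattice_def)
    then have "of_nat N * (inverse (of_nat N) * x $ i) \<in> \<int>" by (rule Ints_mult[OF Ints_of_nat])
    then show ?thesis using assms(1) by (simp add: mult.assoc[symmetric])
  qed
  then show ?thesis by (simp add: int_lattice_def)
qed

lemma balanced_outside: "0 < N \<Longrightarrow> x \<notin> int_lattice \<Longrightarrow> balanced N x = 0"
  using scaled_lattice_imp by (auto simp: balanced_def)

lemma norm_balanced_le: "norm (balanced N (x :: rat ^ 'k)) \<le> 1 + of_nat (N ^ CARD('k))"
proof -
  have "norm (balanced N x) \<le> norm (if x \<in> int_lattice then 1 else 0 :: complex) +
     norm (of_nat (N ^ CARD('k)) * (if inverse (of_nat N) *s x \<in> int_lattice then 1 else 0) :: complex)"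
    unfolding balanced_def by (rule norm_triangle_ineq4)
  also have "\<dots> \<le> 1 + of_nat (N ^ CARD('k))" by (intro add_mono) (auto simp: norm_power)
  finally show ?thesis .
qed

lemma unique_cube_representative:
  fixes x :: "rat ^ 'k"
  assumes "0 < N" "x \<in> int_lattice"
  shows "\<exists>!v. v \<in> cube N \<and> inverse (of_nat N) *s (x - v) \<in> int_lattice"
proof -
  define z where "z i = \<lfloor>x $ i\<rfloor>" for i
  have z: "x $ i = of_int (z i)" for i
    using assms(2) by (simp add: z_def int_lattice_def)
  have key: "inverse (of_nat N) * (x $ i - of_nat n) \<in> \<int> \<longleftrightarrow> int n = z i mod int N" if "n < N" for i n
  proof
    assume "inverse (of_nat N) * (x $ i - of_nat n) \<in> \<int>"
    then obtain m where "inverse (of_nat N) * (x $ i - of_nat n) = of_int m" by (rule Ints_cases)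
    then have "of_int (z i - int n) = (of_int (m * int N) :: rat)"
      using assms(1) z[of i] by (simp add: field_simps)
    then have "z i = int n + m * int N" by (simp only: of_int_eq_iff)
    then show "int n = z i mod int N" using that by simp
  next
    assume "int n = z i mod int N"
    then have "z i - int n = int N * (z i div int N)" by (simp add: minus_mod_eq_mult_div)
    then have "x $ i - of_nat n = of_nat N * of_int (z i div int N)"
      using z[of i] by (metis of_int_diff of_int_mult of_int_of_nat_eq)
    then have "inverse (of_nat N) * (x $ i - of_nat n) = of_int (z i div int N)"
      using assms(1) by (simp add: field_simps)
    then show "inverse (of_nat N) * (x $ i - of_nat n) \<in> \<int>" by simp
  qed
  show ?thesis
  proof (rule ex1I[of _ "\<chi> i. of_nat (nat (z i mod int N))"])
    define n where "n i = nat (z i mod int N)" for i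
    have n: "n i < N" "int (n i) = z i mod int N" for i
      using assms(1) by (simp_all add: n_def nat_less_iff)
    then have "(\<chi> i. of_nat (n i)) \<in> cube N \<and>
        inverse (of_nat N) *s (x - (\<chi> i. of_nat (n i))) \<in> int_lattice"
      using key[OF n(1)] by (simp add: cube_def vecs_in_def int_lattice_def del: vector_ssub_ldistrib)
    then show "(\<chi> i. of_nat (nat (z i mod int N))) \<in> cube N \<and>
        inverse (of_nat N) *s (x - (\<chi> i. of_nat (nat (z i mod int N)))) \<in> int_lattice"
      by (simp only: n_def)
  next
    fix v :: "rat ^ 'k" assume v: "v \<in> cube N \<and> inverse (of_nat N) *s (x - v) \<in> int_lattice"
    have "v $ i = of_nat (nat (z i mod int N))" for i
    proof -
      obtain n where "v $ i = of_nat n" "n < N" using v by (auto simp: cube_def vecs_in_def)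
      moreover have "inverse (of_nat N) * (x $ i - v $ i) \<in> \<int>"
        using v by (simp add: int_lattice_def del: vector_ssub_ldistrib)
      ultimately have "v $ i = of_nat n" "int n = z i mod int N" using key[of n i] by auto
      then show ?thesis by (metis nat_int)
    qed
    then show "v = (\<chi> i. of_nat (nat (z i mod int N)))" by (simp add: vec_eq_iff)
  qed
qed

text \<open>The translate \<open>x - cube N\<close> of a lattice point \<open>x\<close> contains \<open>N ^ k\<close> lattice points, exactly
  one of which is divisible by \<open>N\<close>.\<close>

lemma sum_balanced_cube:
  fixes x :: "rat ^ 'k"
  assumes "0 < N"
  shows "(\<Sum>v\<in>cube N. balanced N (x - v)) = 0"
proof (cases "x \<in> int_lattice")
  case True
  obtain u where u: "u \<in> cube N" "\<And>v. v \<in> cube N \<Longrightarrow> inverse (of_nat N) *s (x - v) \<in> int_lattice \<longleftrightarrow> v = u"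
    using unique_cube_representative[OF assms True] by metis
  have "x - v \<in> int_lattice" if "v \<in> cube N" for v
    using True that cube_subset by (blast intro: int_lattice_diff)
  then have "(\<Sum>v\<in>cube N. balanced N (x - v)) = (\<Sum>v\<in>cube N. 1 - of_nat (N ^ CARD('k)) * (if v = u then 1 else 0))"
    by (intro sum.cong) (simp_all add: balanced_def u del: vector_ssub_ldistrib)
  also have "\<dots> = 0"
    by (simp add: sum_subtractf sum_distrib_left[symmetric] finite_cube u card_cube)
  finally show ?thesis .
next
  case False
  have "x - v \<notin> int_lattice" if "v \<in> cube N" for v
    using False int_lattice_add[of "x - v" v] that cube_subset by auto
  then show ?thesis using assms by (simp add: balanced_outside)
qed



section \<open>Summation by parts through convolution\<close>

definition conv_power :: "('g::ab_group_add \<Rightarrow> complex) \<Rightarrow> nat \<Rightarrow> 'g \<Rightarrow> complex" where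
  "conv_power c m = (conv c ^^ m) (\<lambda>x. if x = 0 then 1 else 0)"

lemma conv_power_simps:
  "conv_power c 0 = (\<lambda>x. if x = 0 then 1 else 0)" "conv_power c (Suc m) = conv c (conv_power c m)"
  by (simp_all add: conv_power_def)

lemma conv_delta: "conv (\<lambda>x. if x = 0 then 1 else 0) a = a"
proof -
  have "{x::'a. (if x = 0 then 1 else 0::complex) \<noteq> 0} = {0}" by auto
  then show ?thesis by (simp add: conv_def[abs_def])
qed

lemma conv_power_finite_total_mass:
  assumes "finite {x. c x \<noteq> 0}"
  shows "finite {x. conv_power c m x \<noteq> 0} \<and> total_mass (conv_power c m) = total_mass c ^ m"
proof (induction m)
  case 0
  have "{x::'a. (if x = 0 then 1 else 0::complex) \<noteq> 0} = {0}" by auto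
  then show ?case by (simp add: conv_power_simps total_mass_def)
next
  case (Suc m)
  then show ?case
    using finite_supp_conv[OF assms] total_mass_conv[OF assms] by (simp add: conv_power_simps)
qed

lemma conv_conv_power_Suc:
  assumes "finite {x. c x \<noteq> 0}"
  shows "conv (conv_power c (Suc m)) a = conv c (conv (conv_power c m) a)"
  using conv_assoc[OF assms] conv_power_finite_total_mass[OF assms] by (simp add: conv_power_simps)

definition ind :: "'g set \<Rightarrow> 'g \<Rightarrow> complex" where
  "ind B x = (if x \<in> B then 1 else 0)"

lemma supp_ind: "{x. ind B x \<noteq> 0} = B"
  by (auto simp: ind_def)

lemma total_mass_ind: "total_mass (ind B) = of_nat (card B)"
  unfolding total_mass_def supp_ind by (simp add: ind_def)

lemma conv_ind: "conv (ind B) a x = (\<Sum>v\<in>B. a (x - v))"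
  unfolding conv_def supp_ind by (simp add: ind_def)

text \<open>One convolution gives \<open>\<Sum>v\<in>B. F (x - v) * \<phi> (x - v)\<close>, and subtracting
  \<open>F x * (\<Sum>v\<in>B. \<phi> (x - v)) = 0\<close> replaces \<open>F (x - v)\<close> by a difference. The factor \<open>\<phi>\<close> is merely
  translated, so it keeps its mean zero property and the step can be repeated.\<close>

lemma conv_power_ind_eq_sum_iter_diff:
  fixes \<phi> F :: "'g::ab_group_add \<Rightarrow> complex"
  assumes "finite B" and mean_zero: "\<And>x. (\<Sum>v\<in>B. \<phi> (x - v)) = 0"
  shows "conv (conv_power (ind B) m) (\<lambda>x. F x * \<phi> x) x =
     (\<Sum>vs | set vs \<subseteq> B \<and> length vs = m. iter_diff vs F x * \<phi> (x - sum_list vs))"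
proof (induction m arbitrary: x)
  case 0
  have "{vs. set vs \<subseteq> B \<and> length vs = 0} = {[]}" by auto
  then show ?case by (simp add: conv_power_simps conv_delta)
next
  case (Suc m)
  define V where "V = {vs. set vs \<subseteq> B \<and> length vs = m}"
  have lists: "{vs. set vs \<subseteq> B \<and> length vs = Suc m} = (\<lambda>(v, vs). v # vs) ` (B \<times> V)"
    by (auto simp: V_def length_Suc_conv image_iff)
  have "conv (conv_power (ind B) (Suc m)) (\<lambda>x. F x * \<phi> x) x =
      (\<Sum>v\<in>B. \<Sum>vs\<in>V. iter_diff vs F (x - v) * \<phi> (x - v - sum_list vs))"
    using assms(1) by (simp add: conv_conv_power_Suc supp_ind conv_ind Suc.IH V_def)
  also have "\<dots> = (\<Sum>v\<in>B. \<Sum>vs\<in>V. iter_diff (v # vs) F x * \<phi> (x - sum_list (v # vs))) +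
      (\<Sum>v\<in>B. \<Sum>vs\<in>V. iter_diff vs F x * \<phi> (x - sum_list vs - v))"
    by (simp add: sum.distrib[symmetric] algebra_simps diff_diff_eq)
  also have "(\<Sum>v\<in>B. \<Sum>vs\<in>V. iter_diff vs F x * \<phi> (x - sum_list vs - v)) = 0"
    by (subst sum.swap) (simp add: sum_distrib_left[symmetric] mean_zero)
  also have "(\<Sum>v\<in>B. \<Sum>vs\<in>V. iter_diff (v # vs) F x * \<phi> (x - sum_list (v # vs))) =
      (\<Sum>vs | set vs \<subseteq> B \<and> length vs = Suc m. iter_diff vs F x * \<phi> (x - sum_list vs))"
    unfolding lists
    by (subst sum.reindex) (auto simp: inj_on_def sum.cartesian_product intro!: sum.cong)
  finally show ?case by simp
qed

lemma iter_diff_real_vec: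
  "iter_diff vs (\<lambda>x. F (real_vec x)) x = iter_diff (map real_vec vs) F (real_vec x)"
  by (induction vs arbitrary: x) auto

section \<open>Summation of the series away from the exceptional point\<close>

locale homogeneous_pair =
  fixes f g :: "real ^ 'k \<Rightarrow> complex" and s0 :: complex
  assumes smooth_f: "smooth_on f (- {0})" and smooth_g: "smooth_on g (- {0})"
    and hom_f: "homogeneous_of_type 1 1 f" and hom_g: "homogeneous_of_type s0 1 g"
    and f_pos: "\<And>x. x \<noteq> 0 \<Longrightarrow> f x \<in> \<real> \<and> 0 < Re (f x)"
begin

text \<open>The value \<open>0\<close> at the origin makes the zero extension of the series the restriction of
  \<open>summand s\<close> to the lattice, so that the identities for convolutions hold
  at every lattice point.\<close>

definition summand :: "complex \<Rightarrow> real ^ 'k \<Rightarrow> complex" where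
  "summand s y = (if y = 0 then 0 else f y powr (- s) * g y)"

lemma f_nonzero: "y \<noteq> 0 \<Longrightarrow> f y \<noteq> 0"
  using f_pos[of y] by auto

lemma summand_scale:
  assumes "0 < t"
  shows "summand s (t *\<^sub>R y) = complex_of_real t powr (s0 - s) * summand s y"
proof (cases "y = 0")
  case False
  have "f (t *\<^sub>R y) = complex_of_real t * f y" "g (t *\<^sub>R y) = complex_of_real t powr s0 * g y"
    using hom_f hom_g assms False by (auto simp: homogeneous_of_type_def)
  moreover have "(complex_of_real t * f y) powr (- s) = complex_of_real t powr (- s) * f y powr (- s)"
    using f_pos[OF False] assms by (intro powr_times_real) auto
  moreover have "complex_of_real t powr (s0 - s) = complex_of_real t powr s0 * complex_of_real t powr (- s)"
    by (simp add: powr_add[symmetric])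
  ultimately show ?thesis using assms False by (simp add: summand_def)
qed (simp add: summand_def)

lemma Ck_param_summand: "Ck_param n summand (- {0})"
proof (rule Ck_param_cong)
  show "Ck_param n (\<lambda>s y. f y powr (- (s + 0)) * g y) (- {0})"
    using smooth_g f_pos
    by (intro Ck_param_mult Ck_param_powr[OF smooth_f] Ck_on_imp_Ck_param) (auto simp: smooth_on_def)
qed (auto simp: summand_def)

lemma summand_holomorphic: "(\<lambda>s. summand s y) holomorphic_on A"
  using f_nonzero[of y] by (cases "y = 0") (auto simp: summand_def intro!: holomorphic_intros)

definition term_ext :: "complex \<Rightarrow> rat ^ 'k \<Rightarrow> complex" where
  "term_ext s = zero_ext (int_lattice - {0}) (\<lambda>n. f (real_vec n) powr (- s) * g (real_vec n))"

lemma term_ext_eq: "term_ext s x = (if x \<in> int_lattice then summand s (real_vec x) else 0)"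
  by (auto simp: term_ext_def zero_ext_def summand_def)

definition z0 :: complex where "z0 = of_nat CARD('k) + s0"

definition dilation :: "nat \<Rightarrow> complex \<Rightarrow> rat \<Rightarrow> complex" where
  "dilation N s t = (if t = 1 then 1 else if t = of_nat N then - (of_nat N powr (z0 - s)) else 0)"

lemma dilation_support:
  assumes "2 \<le> N"
  shows "{t. dilation N s t \<noteq> 0} = {1, of_nat N}"
  using assms by (auto simp: dilation_def)

lemma total_mass_dilation:
  assumes "2 \<le> N"
  shows "total_mass (dilation N s) = 1 - of_nat N powr (z0 - s)"
proof -
  have "(of_nat N :: rat) \<noteq> 1" using assms by auto
  then show ?thesis unfolding total_mass_def dilation_support[OF assms] by (simp add: dilation_def)
qed

definition balanced_summand :: "nat \<Rightarrow> complex \<Rightarrow> rat ^ 'k \<Rightarrow> complex" where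
  "balanced_summand N s x = summand s (real_vec x) * balanced N x"

text \<open>On \<open>N\<Lambda>\<close> the dilated series has the terms \<open>N powr -(s0 - s) * summand s x\<close> by homogeneity, so the
  coefficient \<open>N powr (z0 - s)\<close> leaves the factor \<open>N ^ k\<close> that occurs in \<open>balanced\<close>.\<close>

lemma rho_comb_dilation:
  assumes "2 \<le> N"
  shows "rho_comb (dilation N s) (term_ext s) = balanced_summand N s"
proof
  fix x :: "rat ^ 'k"
  have N: "(of_nat N :: rat) \<noteq> 1" "0 < N" using assms by auto
  have "rho_comb (dilation N s) (term_ext s) x =
      term_ext s x - of_nat N powr (z0 - s) * term_ext s (inverse (of_nat N) *s x)"
    using N unfolding rho_comb_def dilation_support[OF assms] by (simp add: dilation_def rho_def)
  also have "\<dots> = balanced_summand N s x"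
  proof (cases "x \<in> int_lattice")
    case False
    then have "inverse (of_nat N) *s x \<notin> int_lattice" using scaled_lattice_imp[OF N(2)] by blast
    with False show ?thesis by (simp add: term_ext_eq balanced_summand_def balanced_outside N)
  next
    case True
    have "of_nat N powr (z0 - s) * summand s (real_vec (inverse (of_nat N) *s x)) = of_nat (N ^ CARD('k)) * summand s (real_vec x)"
    proof -
      have Npos: "0 < inverse (real N)" using N by simp
      have "summand s (real_vec (inverse (of_nat N) *s x)) = summand s (inverse (real N) *\<^sub>R real_vec x)"
        by (simp add: of_rat_inverse)
      also have "\<dots> = complex_of_real (inverse (real N)) powr (s0 - s) * summand s (real_vec x)"
        using Npos by (rule summand_scale)
      also have "complex_of_real (inverse (real N)) powr (s0 - s) = of_nat N powr (- (s0 - s))"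
        using N by (simp add: powr_def Ln_inverse exp_minus[symmetric] left_diff_distrib)
      finally have "of_nat N powr (z0 - s) * summand s (real_vec (inverse (of_nat N) *s x)) =
          of_nat N powr (z0 - s + - (s0 - s)) * summand s (real_vec x)"
        by (simp only: powr_add mult.assoc)
      also have "z0 - s + - (s0 - s) = of_nat CARD('k)" by (simp add: z0_def)
      also have "of_nat N powr (of_nat CARD('k)) = (of_nat (N ^ CARD('k)) :: complex)"
        using N by (simp add: powr_nat')
      finally show ?thesis .
    qed
    with True show ?thesis by (auto simp: term_ext_eq balanced_summand_def balanced_def algebra_simps)
  qed
  finally show "rho_comb (dilation N s) (term_ext s) x = balanced_summand N s x" .
qed

abbreviation averaged :: "nat \<Rightarrow> nat \<Rightarrow> complex \<Rightarrow> rat ^ 'k \<Rightarrow> complex" where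
  "averaged N m s \<equiv> conv (conv_power (ind (cube N)) m) (balanced_summand N s)"

lemma averaged_holomorphic: "(\<lambda>s. averaged N m s x) holomorphic_on A"
  unfolding conv_def balanced_summand_def by (intro holomorphic_intros summand_holomorphic)

lemma averaged_eq:
  assumes "0 < N"
  shows "averaged N m s x = (\<Sum>vs | set vs \<subseteq> cube N \<and> length vs = m.
           iter_diff (map real_vec vs) (summand s) (real_vec x) * balanced N (x - sum_list vs))"
  using conv_power_ind_eq_sum_iter_diff[OF finite_cube sum_balanced_cube[OF assms],
      where F = "\<lambda>x. summand s (real_vec x)" and x = x and m = m]
  by (simp add: balanced_summand_def[abs_def] iter_diff_real_vec)

lemma averaged_outside:
  assumes "0 < N" "x \<notin> int_lattice"
  shows "averaged N m s x = 0"
proof -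
  have "x - sum_list vs \<notin> int_lattice" if "set vs \<subseteq> cube N" for vs
  proof -
    have "sum_list vs \<in> int_lattice"
      using that
    proof (induction vs)
      case (Cons v vs)
      then show ?case using int_lattice_add[of v "sum_list vs"] cube_subset[of N] by auto
    qed (simp add: int_lattice_def)
    then show ?thesis using assms(2) int_lattice_add[of "x - sum_list vs" "sum_list vs"] by auto
  qed
  then show ?thesis unfolding averaged_eq[OF assms(1)]
    by (intro sum.neutral) (auto simp: balanced_outside assms)
qed

text \<open>Far from the origin the decay of iterated differences applies. The remaining lattice points are
  finite in number, and at each of them the term is continuous in \<open>s\<close>, hence bounded on \<open>K\<close>.\<close>

lemma averaged_dominated:
  assumes N: "0 < N" and K: "compact K" and m: "\<And>s. s \<in> K \<Longrightarrow> Re s0 - Re s + 2 * real CARD('k) \<le> real m"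
  shows "\<exists>M. M summable_on UNIV \<and> (\<forall>s\<in>K. \<forall>x. norm (averaged N m s x) \<le> M x)"
proof -
  define V where "V = {vs :: (rat ^ 'k) list. set vs \<subseteq> cube N \<and> length vs = m}"
  have V: "finite V" unfolding V_def by (rule finite_lists_length_eq[OF finite_cube])
  define L where "L vs = 2 * sum_list (map norm (map real_vec vs))" for vs :: "(rat ^ 'k) list"
  have L0: "0 \<le> L vs" for vs
    unfolding L_def by (intro mult_nonneg_nonneg sum_list_nonneg) auto
  have "\<exists>C\<ge>0. \<forall>s\<in>K. \<forall>y. y \<noteq> 0 \<longrightarrow> L vs \<le> norm y \<longrightarrow>
      norm (iter_diff (map real_vec vs) (summand s) y) \<le> C * norm y powr (Re (s0 - s) - m)" if "vs \<in> V" for vs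
    using iter_diff_decay[OF K Ck_param_summand summand_scale, of "map real_vec vs"] that
    by (simp add: L_def V_def)
  then obtain C where C: "\<And>vs. vs \<in> V \<Longrightarrow> 0 \<le> C vs"
    "\<And>vs s y. vs \<in> V \<Longrightarrow> s \<in> K \<Longrightarrow> y \<noteq> 0 \<Longrightarrow> L vs \<le> norm y \<Longrightarrow>
      norm (iter_diff (map real_vec vs) (summand s) y) \<le> C vs * norm y powr (Re (s0 - s) - m)"
    by metis
  \<comment> \<open>a single radius beyond which the decay estimate holds for every \<open>vs\<close>\<close>
  define R where "R = (\<Sum>vs\<in>V. L vs)"
  define c where "c = 1 + real (N ^ CARD('k))"
  define M1 where "M1 x = (if x \<in> int_lattice then (\<Sum>vs\<in>V. C vs) * c * 2 ^ CARD('k) * lattice_weight x else 0)"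
    for x :: "rat ^ 'k"
  have "\<exists>B. \<forall>s\<in>K. norm (averaged N m s x) \<le> B" for x
  proof -
    have "bounded ((\<lambda>s. averaged N m s x) ` K)"
      by (intro compact_imp_bounded compact_continuous_image K holomorphic_on_imp_continuous_on averaged_holomorphic)
    then show ?thesis by (auto simp: bounded_iff)
  qed
  then obtain B where B: "\<And>s x. s \<in> K \<Longrightarrow> norm (averaged N m s x) \<le> B x" by metis
  define near where "near = {x \<in> int_lattice. norm (real_vec (x :: rat ^ 'k)) \<le> R}"
  define M2 where "M2 x = (if x \<in> near then \<bar>B x\<bar> else 0)" for x
  have "M1 summable_on UNIV"
  proof -
    have "(\<lambda>x :: rat ^ 'k. (\<Sum>vs\<in>V. C vs) * c * 2 ^ CARD('k) * lattice_weight x) summable_on int_lattice"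
      by (intro summable_on_cmult_right summable_on_lattice_weight)
    then show ?thesis
      by (rule summable_on_cong_neutral[THEN iffD1, rotated -1]) (auto simp: M1_def)
  qed
  moreover have "M2 summable_on UNIV"
  proof -
    have "(\<lambda>x. \<bar>B x\<bar>) summable_on near"
      unfolding near_def by (intro summable_on_finite finite_lattice_ball)
    then show ?thesis
      by (rule summable_on_cong_neutral[THEN iffD1, rotated -1]) (auto simp: M2_def)
  qed
  ultimately have "(\<lambda>x. M1 x + M2 x) summable_on UNIV" by (rule summable_on_add)
  moreover have "norm (averaged N m s x) \<le> M1 x + M2 x" if s: "s \<in> K" for s x
  proof -
    have c0: "0 \<le> c" by (simp add: c_def)
    have "0 \<le> lattice_weight x" by (auto simp: lattice_weight_def intro: prod_nonneg)
    then have M1: "0 \<le> M1 x" using C(1) c0 by (simp add: M1_def sum_nonneg)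
    have M2: "0 \<le> M2 x" by (simp add: M2_def)
    consider "x \<notin> int_lattice" | "x \<in> near" | "x \<in> int_lattice" "R < norm (real_vec x)"
      unfolding near_def by fastforce
    then show ?thesis
    proof cases
      case 1
      then show ?thesis using averaged_outside[OF N] M1 M2 by simp
    next
      case 2
      have "norm (averaged N m s x) \<le> \<bar>B x\<bar>" using B[OF s, of x] by linarith
      with 2 M1 show ?thesis by (simp add: M2_def)
    next
      case 3
      have "0 \<le> R" unfolding R_def by (intro sum_nonneg L0)
      with 3 have x0: "x \<noteq> 0" by auto
      have "norm (averaged N m s x) \<le>
          (\<Sum>vs\<in>V. norm (iter_diff (map real_vec vs) (summand s) (real_vec x)) * norm (balanced N (x - sum_list vs)))"
        unfolding averaged_eq[OF N] V_def[symmetric] norm_mult[symmetric] by (rule norm_sum)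
      also have "\<dots> \<le> (\<Sum>vs\<in>V. (C vs * (2 ^ CARD('k) * lattice_weight x)) * c)"
      proof (rule sum_mono)
        fix vs assume vs: "vs \<in> V"
        have "L vs \<le> R" unfolding R_def by (rule member_le_sum) (use vs V L0 in auto)
        then have "norm (iter_diff (map real_vec vs) (summand s) (real_vec x)) \<le> C vs * norm (real_vec x) powr (Re (s0 - s) - m)"
          using C(2)[OF vs s, of "real_vec x"] 3 x0 by simp
        also have "\<dots> \<le> C vs * (2 ^ CARD('k) * lattice_weight x)"
          using m[OF s] by (intro mult_left_mono C(1) vs norm_powr_le_lattice_weight 3 x0) auto
        finally show "norm (iter_diff (map real_vec vs) (summand s) (real_vec x)) * norm (balanced N (x - sum_list vs))
            \<le> (C vs * (2 ^ CARD('k) * lattice_weight x)) * c"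
          unfolding c_def using C(1)[OF vs] \<open>0 \<le> lattice_weight x\<close>
          by (intro mult_mono norm_balanced_le[unfolded of_nat_add]) auto
      qed
      also have "\<dots> = (\<Sum>vs\<in>V. C vs) * (2 ^ CARD('k) * lattice_weight x) * c"
        unfolding sum_distrib_right ..
      also have "\<dots> = M1 x" using 3 by (simp add: M1_def)
      finally show ?thesis using M2 by simp
    qed
  qed
  ultimately show ?thesis by blast
qed

text \<open>The half plane on which \<open>m\<close> convolutions make the terms decay faster than the exponent \<open>-2k\<close>.\<close>

definition region :: "nat \<Rightarrow> complex set" where
  "region m = {s. Re s0 + 2 * real CARD('k) - real m < Re s}"

lemma open_region: "open (region m)"
  unfolding region_def by (rule open_halfspace_Re_gt)

definition averaged_sum :: "nat \<Rightarrow> nat \<Rightarrow> complex \<Rightarrow> complex" where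
  "averaged_sum N m s = (\<Sum>\<^sub>\<infinity>x. averaged N m s x)"

lemma averaged_sum_holomorphic:
  assumes "0 < N"
  shows "averaged_sum N m holomorphic_on region m"
proof -
  have "averaged_sum N m field_differentiable at s" if s: "s \<in> region m" for s
  proof -
    obtain r where r: "0 < r" "cball s r \<subseteq> region m"
      using open_region[of m] s unfolding open_contains_cball by auto
    have "Re s0 - Re u + 2 * real CARD('k) \<le> real m" if "u \<in> cball s r" for u
    proof -
      have "u \<in> region m" using r(2) that by blast
      then show ?thesis by (simp add: region_def)
    qed
    then have "\<exists>M. M summable_on UNIV \<and> (\<forall>u\<in>cball s r. \<forall>x. norm (averaged N m u x) \<le> M x)"
      by (rule averaged_dominated[OF assms compact_cball])
    then obtain M where M: "M summable_on UNIV" "\<And>u x. u \<in> cball s r \<Longrightarrow> norm (averaged N m u x) \<le> M x"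
      by blast
    have limit: "uniform_limit (cball s r) (\<lambda>X u. \<Sum>x\<in>X. averaged N m u x) (averaged_sum N m) (finite_subsets_at_top UNIV)"
      unfolding averaged_sum_def[abs_def] by (rule Weierstrass_m_test_general[OF _ M(1)]) (rule M(2))
    have partial: "\<forall>\<^sub>F X in finite_subsets_at_top UNIV. continuous_on (cball s r) (\<lambda>u. \<Sum>x\<in>X. averaged N m u x) \<and>
        (\<lambda>u. \<Sum>x\<in>X. averaged N m u x) holomorphic_on ball s r"
    proof (rule always_eventually, rule allI)
      fix X :: "(rat ^ 'k) set"
      have "(\<lambda>u. \<Sum>x\<in>X. averaged N m u x) holomorphic_on A" for A
        by (intro holomorphic_on_sum averaged_holomorphic)
      then show "continuous_on (cball s r) (\<lambda>u. \<Sum>x\<in>X. averaged N m u x) \<and>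
          (\<lambda>u. \<Sum>x\<in>X. averaged N m u x) holomorphic_on ball s r"
        by (simp add: holomorphic_on_imp_continuous_on)
    qed
    have "averaged_sum N m holomorphic_on ball s r"
      by (rule holomorphic_uniform_limit[OF partial limit]) simp_all
    then show ?thesis using r(1) by (intro holomorphic_on_imp_differentiable_at[of _ "ball s r"]) auto
  qed
  then show ?thesis by (auto simp: holomorphic_on_def intro: field_differentiable_at_within)
qed

text \<open>The power of the cube indicator is an admissible kernel for t-summation: its total mass
  \<open>(N ^ k) ^ m\<close> is nonzero.\<close>

lemma t_sum_balanced_summand:
  assumes "0 < N" "s \<in> region m"
  shows "t_summable (balanced_summand N s) \<and> t_sum (balanced_summand N s) = averaged_sum N m s / of_nat (N ^ CARD('k)) ^ m"
proof -
  obtain M where M: "M summable_on UNIV" "\<And>x. norm (averaged N m s x) \<le> M x"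
    using averaged_dominated[OF assms(1), of "{s}" m] assms(2) by (auto simp: region_def)
  have fin: "finite {x. ind (cube N :: (rat ^ 'k) set) x \<noteq> 0}" by (simp add: supp_ind finite_cube)
  have mass: "total_mass (conv_power (ind (cube N :: (rat ^ 'k) set)) m) = of_nat (N ^ CARD('k)) ^ m"
    using conv_power_finite_total_mass[OF fin] by (simp add: total_mass_ind card_cube)
  have "(\<lambda>x. norm (averaged N m s x)) summable_on UNIV"
    using M(1) by (rule summable_on_comparison_test) (use M(2) in auto)
  then have "t_summing (conv_power (ind (cube N)) m) (balanced_summand N s)"
    unfolding t_summing_def mass using conv_power_finite_total_mass[OF fin] assms(1) by simp
  from t_sum_eq[OF this] this show ?thesis
    unfolding mass t_summable_def averaged_sum_def by blast
qed

definition h :: "complex \<Rightarrow> complex" where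
  "h s = h_sum (\<lambda>n. f (real_vec n) powr (- s) * g (real_vec n)) (int_lattice - {0})"

text \<open>The h-sum is independent of the chosen dilations, so these expressions agree for all admissible
  \<open>N\<close> and \<open>m\<close>; the freedom in \<open>N\<close> avoids the zeros of the denominator, and the freedom in \<open>m\<close> reaches
  every \<open>s\<close>.\<close>

lemma h_eq:
  assumes "2 \<le> N" "s \<in> region m" "of_nat N powr (z0 - s) \<noteq> 1"
  shows "h_summing (dilation N s) (term_ext s)"
    "h s = averaged_sum N m s / of_nat (N ^ CARD('k)) ^ m / (1 - of_nat N powr (z0 - s))"
proof -
  have N: "0 < N" using assms(1) by simp
  have "finite {t. dilation N s t \<noteq> 0}" "dilation N s 0 = 0" "total_mass (dilation N s) \<noteq> 0"
    unfolding dilation_support[OF assms(1)]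
    using assms by (simp_all add: total_mass_dilation dilation_def)
  then show *: "h_summing (dilation N s) (term_ext s)"
    using t_sum_balanced_summand[OF N assms(2)] by (simp add: h_summing_def rho_comb_dilation[OF assms(1)])
  show "h s = averaged_sum N m s / of_nat (N ^ CARD('k)) ^ m / (1 - of_nat N powr (z0 - s))"
    using h_sum_eq[OF *[unfolded term_ext_def]] t_sum_balanced_summand[OF N assms(2)]
    by (simp add: h_def term_ext_def[symmetric] rho_comb_dilation[OF assms(1)] total_mass_dilation[OF assms(1)])
qed

lemma in_some_region: "\<exists>m. s \<in> region m"
proof -
  obtain m where "Re s0 + 2 * real CARD('k) - Re s + 1 \<le> real m"
    using real_arch_simple[of "Re s0 + 2 * real CARD('k) - Re s + 1"] by blast
  then show ?thesis by (intro exI[of _ m]) (simp add: region_def)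
qed

end



section \<open>Zeros of the denominators and the exceptional point\<close>

text \<open>Both equations force \<open>w\<close> to be purely imaginary, with \<open>Im w * ln 2\<close> and \<open>Im w * ln 3\<close> in
  \<open>2 * pi * \<int>\<close>. If \<open>Im w\<close> were nonzero, a power of \<open>3\<close> with positive exponent would equal a power of \<open>2\<close>.\<close>

lemma powr_2_3_eq_1_imp:
  fixes w :: complex
  assumes "2 powr w = 1" "3 powr w = 1"
  shows "w = 0"
proof -
  have *: "Re w * ln a = 0 \<and> (\<exists>n::int. Im w * ln a = of_int (2 * n) * pi)"
    if "complex_of_real a powr w = 1" "0 < a" for a
  proof -
    have "exp (w * complex_of_real (ln a)) = 1" using that by (simp add: powr_def Ln_of_real)
    then show ?thesis by (simp only: exp_eq_1) simp
  qed
  obtain m n :: int where mn: "Im w * ln 2 = of_int (2 * m) * pi" "Im w * ln 3 = of_int (2 * n) * pi"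
    using *[of 2] *[of 3] assms by auto
  have Re: "Re w = 0" using *[of 2] assms by auto
  have "Im w = 0"
  proof (rule ccontr)
    assume nz: "Im w \<noteq> 0"
    define a b where "a = nat \<bar>m\<bar>" and "b = nat \<bar>n\<bar>"
    have ab: "real a = \<bar>real_of_int m\<bar>" "real b = \<bar>real_of_int n\<bar>" by (simp_all add: a_def b_def)
    have mn_nz: "m \<noteq> 0" using mn(1) nz by auto
    have "(Im w * ln 2) * (of_int (2 * n) * pi) = (Im w * ln 3) * (of_int (2 * m) * pi)"
      unfolding mn by (simp add: mult_ac)
    then have "of_int n * ln 2 = of_int m * ln (3::real)" using nz by (simp add: field_simps)
    then have "\<bar>of_int n\<bar> * \<bar>ln 2\<bar> = \<bar>of_int m\<bar> * \<bar>ln (3::real)\<bar>" by (metis abs_mult)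
    then have "real b * ln 2 = real a * ln 3" by (simp add: ab)
    then have "ln (2 ^ b) = ln (3 ^ a :: real)" by (simp add: ln_realpow)
    then have "(2::real) ^ b = 3 ^ a" by simp
    then have "(2::nat) ^ b = 3 ^ a" by (metis of_nat_eq_iff of_nat_numeral of_nat_power)
    moreover have "odd ((3::nat) ^ a)" by simp
    ultimately have "b = 0" by (metis even_power even_numeral neq0_conv)
    with \<open>(2::nat) ^ b = 3 ^ a\<close> have "(3::nat) ^ a = 1" by simp
    moreover have "(3::nat) dvd 3 ^ a" if "a \<noteq> 0" using that by simp
    ultimately have "a = 0" by fastforce
    with mn_nz show False by (simp add: a_def)
  qed
  with Re show ?thesis by (simp add: complex_eq_iff)
qed

text \<open>If \<open>P z \<noteq> 0\<close> the quotient has a simple pole; otherwise it tends to \<open>P' z\<close>.\<close>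

lemma quotient_by_linear_factor:
  assumes U: "open U" "z \<in> U" and P: "P holomorphic_on U"
    and eq: "\<And>s. s \<in> U \<Longrightarrow> s \<noteq> z \<Longrightarrow> h s = P s / (s - z)"
  shows "not_essential h z \<and> (is_pole h z \<longrightarrow> zorder h z = -1)"
proof (cases "P z = 0")
  case False
  have "is_pole (\<lambda>s. P s / (s - z) ^ 1) z" using is_pole_basic[OF P U False, of 1] by simp
  moreover have "\<forall>\<^sub>F s in at z. h s = P s / (s - z) ^ 1"
    using eq U unfolding eventually_at_topological by auto
  ultimately have "is_pole h z" by (simp add: is_pole_cong)
  moreover have "zorder h z = -1"
    by (rule zorder_eqI[OF U P False]) (simp add: eq power_int_minus divide_inverse)
  ultimately show ?thesis by (simp add: not_essential_def)
next
  case True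
  have "(P has_field_derivative deriv P z) (at z)" using holomorphic_derivI[OF P U] .
  then have "((\<lambda>s. (P s - P z) / (s - z)) \<longlongrightarrow> deriv P z) (at z)" by (simp add: has_field_derivative_iff)
  moreover have "\<forall>\<^sub>F s in at z. (P s - P z) / (s - z) = h s"
    using eq U True unfolding eventually_at_topological by auto
  ultimately have lim: "h \<midarrow>z\<rightarrow> deriv P z" by (rule Lim_transform_eventually)
  then have "\<not> is_pole h z"
    unfolding is_pole_def using not_tendsto_and_filterlim_at_infinity[OF _ lim] by auto
  with lim show ?thesis by (auto simp: not_essential_def)
qed

text \<open>Writing \<open>q s = r s * (s - z)\<close> with \<open>r z = q' z \<noteq> 0\<close> reduces to the linear denominator.\<close>

lemma quotient_by_simple_zero:
  assumes U: "open U" "z \<in> U" and H: "H holomorphic_on U"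
    and q: "q holomorphic_on U" "q z = 0" "deriv q z \<noteq> 0"
    and eq: "\<And>s. s \<in> U \<Longrightarrow> q s \<noteq> 0 \<Longrightarrow> h s = H s / q s"
  shows "not_essential h z \<and> (is_pole h z \<longrightarrow> zorder h z = -1)"
proof -
  define r where "r s = (if s = z then deriv q z else (q s - q z) / (s - z))" for s
  have r: "r holomorphic_on U" unfolding r_def[abs_def] by (rule pole_lemma_open[OF q(1) U(1)])
  define V where "V = U \<inter> r -` (- {0})"
  have "open V"
    unfolding V_def using r U(1) by (intro continuous_open_preimage holomorphic_on_imp_continuous_on) auto
  moreover have "z \<in> V" using U q by (simp add: V_def r_def)
  moreover have "(\<lambda>s. H s / r s) holomorphic_on V"
    using holomorphic_on_subset[OF H, of V] holomorphic_on_subset[OF r, of V]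
    by (intro holomorphic_on_divide) (auto simp: V_def)
  moreover have "h s = H s / r s / (s - z)" if "s \<in> V" "s \<noteq> z" for s
  proof -
    have "q s = r s * (s - z)" using that q(2) by (simp add: r_def)
    with that eq[of s] show ?thesis by (auto simp: V_def)
  qed
  ultimately show ?thesis by (rule quotient_by_linear_factor)
qed

context homogeneous_pair
begin

lemma admissible_dilation:
  assumes "s \<noteq> z0"
  shows "\<exists>N\<ge>2. complex_of_nat N powr (z0 - s) \<noteq> 1"
  using powr_2_3_eq_1_imp[of "z0 - s"] assms exI[of "\<lambda>N. N \<ge> 2 \<and> complex_of_nat N powr (z0 - s) \<noteq> 1" 2]
    exI[of "\<lambda>N. N \<ge> 2 \<and> complex_of_nat N powr (z0 - s) \<noteq> 1" 3] by auto

lemma h_summable: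
  assumes "s \<noteq> z0"
  shows "h_summable_on (\<lambda>n. f (real_vec n) powr (- s) * g (real_vec n)) (int_lattice - {0})"
proof -
  obtain N m where "2 \<le> N" "complex_of_nat N powr (z0 - s) \<noteq> 1" "s \<in> region m"
    using admissible_dilation[OF assms] in_some_region by blast
  then show ?thesis using h_eq(1) unfolding h_summable_on_def term_ext_def by blast
qed

text \<open>Choosing \<open>N\<close> and \<open>m\<close> according to the point gives local holomorphic formulas for \<open>h\<close>, which
  need not be matched, since each of them is valid for \<open>h\<close> itself.\<close>

lemma h_holomorphic: "h holomorphic_on (- {z0})"
proof -
  have "h field_differentiable at s" if s: "s \<noteq> z0" for s
  proof -
    obtain N m where N: "2 \<le> N" "complex_of_nat N powr (z0 - s) \<noteq> 1" and m: "s \<in> region m"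
      using admissible_dilation[OF s] in_some_region by blast
    define q where "q u = 1 - complex_of_nat N powr (z0 - u)" for u
    have q: "q holomorphic_on A" for A
      unfolding q_def[abs_def] using N by (intro holomorphic_intros) auto
    define V where "V = region m \<inter> q -` (- {0})"
    have V: "open V"
      unfolding V_def by (intro continuous_open_preimage holomorphic_on_imp_continuous_on q open_region) auto
    have "averaged_sum N m holomorphic_on V"
      by (rule holomorphic_on_subset[OF averaged_sum_holomorphic]) (use N in \<open>auto simp: V_def\<close>)
    then have "(\<lambda>u. averaged_sum N m u / of_nat (N ^ CARD('k)) ^ m / q u) holomorphic_on V"
      using N by (intro holomorphic_intros q) (auto simp: V_def)
    then have "h holomorphic_on V"
      by (rule holomorphic_transform) (use h_eq(2)[OF N(1)] in \<open>auto simp: V_def q_def\<close>)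
    moreover have "s \<in> V" using m N by (simp add: V_def q_def)
    ultimately show ?thesis using V by (intro holomorphic_on_imp_differentiable_at[of _ V])
  qed
  then show ?thesis by (auto simp: holomorphic_on_def intro: field_differentiable_at_within)
qed

lemma h_at_worst_simple_pole: "not_essential h z0 \<and> (is_pole h z0 \<longrightarrow> zorder h z0 = -1)"
proof -
  obtain m where m: "z0 \<in> region m" using in_some_region by blast
  define q where "q u = 1 - 2 powr (z0 - u)" for u
  have "((\<lambda>u. 2 powr (z0 - u)) has_field_derivative Ln 2 * 2 powr (z0 - z0) * (- 1)) (at z0)"
    by (rule DERIV_chain2[OF has_field_derivative_powr_right]) (auto intro!: derivative_eq_intros)
  then have "(q has_field_derivative 0 - Ln 2 * 2 powr (z0 - z0) * (- 1)) (at z0)"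
    unfolding q_def[abs_def] by (intro DERIV_diff DERIV_const)
  then have "(q has_field_derivative Ln 2) (at z0)" by simp
  then have "deriv q z0 = Ln 2" by (rule DERIV_imp_deriv)
  moreover have "Ln (2::complex) \<noteq> 0" using exp_Ln[of 2] by fastforce
  ultimately have "deriv q z0 \<noteq> 0" by simp
  show ?thesis
  proof (rule quotient_by_simple_zero[OF open_region m])
    show "(\<lambda>s. averaged_sum 2 m s / of_nat (2 ^ CARD('k)) ^ m) holomorphic_on region m"
      by (intro holomorphic_intros averaged_sum_holomorphic) auto
    show "q holomorphic_on region m" unfolding q_def[abs_def] by (intro holomorphic_intros) auto
    show "q z0 = 0" by (simp add: q_def)
    show "deriv q z0 \<noteq> 0" by fact
    show "h s = averaged_sum 2 m s / of_nat (2 ^ CARD('k)) ^ m / q s" if "s \<in> region m" "q s \<noteq> 0" for s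
      using h_eq(2)[of 2 s m] that by (simp add: q_def)
  qed
qed

end

theorem proposition4p6:
  fixes f g :: "real ^ 'k \<Rightarrow> complex" and s0 :: complex
  defines "a \<equiv> (\<lambda>(s::complex) (n::rat ^ 'k). f (real_vec n) powr (- s) * g (real_vec n))"
    and "z0 \<equiv> of_nat CARD('k) + s0"
  defines "h \<equiv> (\<lambda>s. h_sum (a s) (int_lattice - {0}))"
  assumes "smooth_on f (- {0})" and "smooth_on g (- {0})"
    and "homogeneous_of_type 1 1 f" and "homogeneous_of_type s0 1 g"
    and "\<And>x. x \<noteq> 0 \<Longrightarrow> f x \<in> \<real> \<and> 0 < Re (f x)"
  shows "(\<forall>s. s \<noteq> z0 \<longrightarrow> h_summable_on (a s) (int_lattice - {0})) \<and>
    h holomorphic_on (- {z0}) \<and>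
    not_essential h z0 \<and> (is_pole h z0 \<longrightarrow> zorder h z0 = -1)"
proof -
  interpret P: homogeneous_pair f g s0 by unfold_locales (use assms in auto)
  have "z0 = P.z0" "h = P.h" by (auto simp: z0_def P.z0_def h_def a_def P.h_def)
  then show ?thesis
    using P.h_summable P.h_holomorphic P.h_at_worst_simple_pole unfolding a_def by simp
qed


end
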